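(* Over the field $\mathbb{Z}_2$, the cohomology rings $H^*(\mathfrak{m}_0)$ and $H^*(\mathfrak{m}_2)$ are isomorphic. Moreover, the elements $$e^1,\quad e^2,\quad F(e^{i_1}\wedge e^{i_2}\wedge\dots\wedge e^{i_q},\,e^{i_q}),\qquad q\ge 1,\ 2\le i_1<i_2<\dots<i_q,$$ are cocycles both for $\mathfrak{m}_0$ and for $\mathfrak{m}_2$; their cohomology classes in $H^*(\mathfrak{m}_0)$ form a basis of $\bigoplus_{r\ge1}H^r(\mathfrak{m}_0)$, and their cohomology classes in $H^*(\mathfrak{m}_2)$ form a basis of $\bigoplus_{r\ge1}H^r(\mathfrak{m}_2)$.
   Context: All vector spaces are over $\mathbb{Z}_2$. Let $V=\mathrm{Span}(e_1,e_2,\dots)$ be the space with countable basis $e_1,e_2,\dots$. Two Lie algebras are considered on $V$ (brackets of basis elements not listed, and not following by antisymmetry, are zero): - $\mathfrak{m}_0$: $[e_1,e_i]=e_{i+1}$ for $i>1$; - $\mathfrak{m}_2$: $[e_1,e_i]=e_{i+1}$ for $i>1$, and $[e_2,e_j]=e_{j+2}$ for $j>2$. Let $e^i$ be the dual basis elements; here $V^*$ means the span of $e^1,e^2,\dots$, and $\Lambda(V)=\bigoplus_q\Lambda^q(V)$ is the exterior algebra generated by the $e^i$ (so $e^i\wedge e^i=0$), i.e. $\Lambda^q(V)$ consists of finite linear combinations of monomials $e^{i_1}\wedge\dots\wedge e^{i_q}$. For a Lie algebra $\mathfrak{g}$ on $V$, the differential $d$ is defined on one-forms by $d\xi(X,Y)=\xi([X,Y])$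 and extended to the exterior algebra as a derivation, $d(\omega_1\wedge\omega_2)=d\omega_1\wedge\omega_2+\omega_1\wedge d\omega_2$. Explicitly, for $\mathfrak{m}_0$: $de^1=de^2=0$, $de^i=e^1\wedge e^{i-1}$ for $i\ge3$; for $\mathfrak{m}_2$: $de^1=de^2=0$, $de^3=e^1\wedge e^2$, $de^4=e^1\wedge e^3$, $de^i=e^1\wedge e^{i-1}+e^2\wedge e^{i-2}$ for $i\ge5$. Then $H^q(\mathfrak{g})=\ker(d:\Lambda^q\to\Lambda^{q+1})/\mathrm{Im}(d:\Lambda^{q-1}\to\Lambda^q)$, and $H^*(\mathfrak{g})=\bigoplus_q H^q(\mathfrak{g})$ is a ring with multiplication induced by the wedge product. Define the operator $D_1$ on $V^*$ by $D_1e^1=D_1e^2=0$ and $D_1e^i=e^{i-1}$ for $i>2$, and extend it to $\Lambda(V)$ as a derivation. For $\omega\in\Lambda(V)$ and $e^i\in V^*$ define $F(\omega,e^i)=\sum_{l=0}^\infty (D_1^l\omega)\wedge e^{i+l+1}$ (a finite sum, since $D_1^l\omega=0$ for large $l$). *)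

theory Defs
  imports
    "Jordan_Normal_Form.VS_Connect"
    "HOL-Algebra.QuotRing"
    "HOL-Library.Poly_Mapping"
    "HOL-Library.Z2"
begin

section \<open>The space $V$ and the exterior algebra\<close>

text \<open>
  A vector \<open>\<Sum>\<^sub>i x\<^sub>i e\<^sub>i\<close> of $V$ is the finitely supported function \<open>i \<mapsto> x\<^sub>i\<close>, and an exterior form
  is the finitely supported function sending \<open>{i\<^sub>1 < \<dots> < i\<^sub>q}\<close> to the coefficient of
  \<open>e\<^sup>i\<^sup>1 \<and> \<dots> \<and> e\<^sup>i\<^sup>q\<close>. The types admit the index $0$ and infinite index sets;
  \<open>exterior_algebra\<close> excludes both, and all brackets with \<open>e\<^sub>0\<close> are zero.
\<close>

type_synonym vec = "nat \<Rightarrow>\<^sub>0 bit"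
type_synonym form = "nat set \<Rightarrow>\<^sub>0 bit"

definition scale :: "bit \<Rightarrow> ('a \<Rightarrow>\<^sub>0 bit) \<Rightarrow> ('a \<Rightarrow>\<^sub>0 bit)" where
  "scale c x = Poly_Mapping.map ((*) c) x"

definition lin_ext :: "('a \<Rightarrow> ('b \<Rightarrow>\<^sub>0 bit)) \<Rightarrow> ('a \<Rightarrow>\<^sub>0 bit) \<Rightarrow> ('b \<Rightarrow>\<^sub>0 bit)" where
  "lin_ext f x = (\<Sum>a\<in>Poly_Mapping.keys x. scale (Poly_Mapping.lookup x a) (f a))"

definition exterior_algebra :: "form set" where
  "exterior_algebra = {\<omega>. \<forall>I\<in>Poly_Mapping.keys \<omega>. finite I \<and> (\<forall>i\<in>I. 1 \<le> i)}"

definition exterior_power :: "nat \<Rightarrow> form set" where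
  "exterior_power q = {\<omega> \<in> exterior_algebra. \<forall>I\<in>Poly_Mapping.keys \<omega>. card I = q}"

definition monomial :: "nat set \<Rightarrow> form" where
  "monomial I = Poly_Mapping.single I 1"

abbreviation dual_basis :: "nat \<Rightarrow> form" where
  "dual_basis i \<equiv> monomial {i}"

text \<open>No signs are needed, the characteristic being $2$.\<close>

definition wedge :: "form \<Rightarrow> form \<Rightarrow> form" (infixl \<open>\<and>\<^sub>f\<close> 70) where
  "\<omega> \<and>\<^sub>f \<eta> = lin_ext (\<lambda>I. lin_ext (\<lambda>J. if I \<inter> J = {} then monomial (I \<union> J) else 0) \<eta>) \<omega>"

definition wedge_list :: "nat list \<Rightarrow> form" where
  "wedge_list is = foldr (\<lambda>i \<omega>. dual_basis i \<and>\<^sub>f \<omega>) is (monomial {})"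

text \<open>The derivation of the exterior algebra with prescribed values \<open>\<delta> k\<close> on the \<open>e\<^sup>k\<close>
  (see \<open>derivation_e\<close> and \<open>derivation_wedge\<close> below).\<close>

definition derivation :: "(nat \<Rightarrow> form) \<Rightarrow> form \<Rightarrow> form" where
  "derivation \<delta> = lin_ext (\<lambda>I. \<Sum>k\<in>I. \<delta> k \<and>\<^sub>f monomial (I - {k}))"


section \<open>The Lie algebras and their differentials\<close>

text \<open>A Lie algebra structure on $V$ is given by its brackets \<open>[e\<^sub>i, e\<^sub>j]\<close> of basis vectors.
  Antisymmetry reads \<open>[e\<^sub>j, e\<^sub>i] = [e\<^sub>i, e\<^sub>j]\<close> over a field of characteristic $2$.\<close>

type_synonym lie = "nat \<Rightarrow> nat \<Rightarrow> vec"

abbreviation basis_vec :: "nat \<Rightarrow> vec" where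
  "basis_vec i \<equiv> Poly_Mapping.single i 1"

definition m0 :: lie where
  "m0 i j = (if i = 1 \<and> 1 < j then basis_vec (j + 1)
             else if j = 1 \<and> 1 < i then basis_vec (i + 1)
             else 0)"

definition m2 :: lie where
  "m2 i j = (if i = 1 \<and> 1 < j then basis_vec (j + 1)
             else if j = 1 \<and> 1 < i then basis_vec (i + 1)
             else if i = 2 \<and> 2 < j then basis_vec (j + 2)
             else if j = 2 \<and> 2 < i then basis_vec (i + 2)
             else 0)"

definition bracket :: "lie \<Rightarrow> vec \<Rightarrow> vec \<Rightarrow> vec" where
  "bracket \<gg> X Y = lin_ext (\<lambda>i. lin_ext (\<lambda>j. \<gg> i j) Y) X"

text \<open>The coefficient of \<open>e\<^sup>i \<and> e\<^sup>j\<close> (\<open>i < j\<close>) in \<open>d e\<^sup>k\<close> is \<open>e\<^sup>k ([e\<^sub>i, e\<^sub>j])\<close>; the lemma \<open>eval2_lie_diff\<close>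
  below states \<open>d\<xi>(X, Y) = \<xi>([X, Y])\<close> for all one-forms.\<close>

definition lie_diff_dual :: "lie \<Rightarrow> nat \<Rightarrow> form" where
  "lie_diff_dual \<gg> k = (\<Sum>(i, j) | 1 \<le> i \<and> i < j \<and> Poly_Mapping.lookup (\<gg> i j) k \<noteq> 0.
     scale (Poly_Mapping.lookup (\<gg> i j) k) (dual_basis i \<and>\<^sub>f dual_basis j))"

definition lie_diff :: "lie \<Rightarrow> form \<Rightarrow> form" where
  "lie_diff \<gg> = derivation (lie_diff_dual \<gg>)"


section \<open>Cohomology\<close>

definition cocycles :: "lie \<Rightarrow> form set" where
  "cocycles \<gg> = {\<omega> \<in> exterior_algebra. lie_diff \<gg> \<omega> = 0}"

definition coboundaries :: "lie \<Rightarrow> form set" where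
  "coboundaries \<gg> = lie_diff \<gg> ` exterior_algebra"

definition cocycle_ring :: "lie \<Rightarrow> form ring" where
  "cocycle_ring \<gg> = \<lparr>carrier = cocycles \<gg>, mult = wedge, one = monomial {}, zero = 0, add = (+)\<rparr>"

definition cohomology_ring :: "lie \<Rightarrow> form set ring" where
  "cohomology_ring \<gg> = cocycle_ring \<gg> Quot coboundaries \<gg>"

definition cohomology_class :: "lie \<Rightarrow> form \<Rightarrow> form set" where
  "cohomology_class \<gg> \<omega> = coboundaries \<gg> +>\<^bsub>cocycle_ring \<gg>\<^esub> \<omega>"

definition cohomology :: "lie \<Rightarrow> (bit, form set) module" where
  "cohomology \<gg> = ring.extend (cohomology_ring \<gg>)
     (module.fields (\<lambda>c H. \<Union>\<omega>\<in>H. cohomology_class \<gg> (scale c \<omega>)))"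

text \<open>$H^q$ as a subspace of $H^*$. As \<open>lie_diff\<close> is homogeneous of degree one, this is
  the quotient of the $q$-cocycles by the image of $\Lambda^{q-1}$, see \<open>coboundaries_power\<close>.\<close>

definition cohomology_degree :: "lie \<Rightarrow> nat \<Rightarrow> form set set" where
  "cohomology_degree \<gg> q = cohomology_class \<gg> ` (cocycles \<gg> \<inter> exterior_power q)"

definition positive_cohomology :: "lie \<Rightarrow> (bit, form set) module" where
  "positive_cohomology \<gg> = (cohomology \<gg>)
     \<lparr>carrier := LinearCombinations.module.span class_ring (cohomology \<gg>)
                  (\<Union>r\<in>{1..}. cohomology_degree \<gg> r)\<rparr>"


section \<open>The operators $D_1$ and $F$\<close>

definition D1 :: "form \<Rightarrow> form" where
  "D1 = derivation (\<lambda>i. if 2 < i then dual_basis (i - 1) else 0)"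

definition F_op :: "form \<Rightarrow> nat \<Rightarrow> form" where
  "F_op \<omega> i = Sum_any (\<lambda>l. (D1 ^^ l) \<omega> \<and>\<^sub>f dual_basis (i + l + 1))"

text \<open>The cocycles \<open>e\<^sup>1\<close>, \<open>e\<^sup>2\<close> and \<open>F (e\<^sup>i\<^sup>1 \<and> \<dots> \<and> e\<^sup>i\<^sup>q, e\<^sup>i\<^sup>q)\<close> as one indexed family; a list is a
  sequence \<open>2 \<le> i\<^sub>1 < \<dots> < i\<^sub>q\<close> with \<open>q \<ge> 1\<close>.\<close>

definition generator_index :: "(nat + nat list) set" where
  "generator_index =
     {1, 2} <+> {is. is \<noteq> [] \<and> sorted_wrt (<) is \<and> (\<forall>i\<in>set is. 2 \<le> i)}"

definition generator :: "nat + nat list \<Rightarrow> form" where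
  "generator x = (case x of Inl k \<Rightarrow> dual_basis k | Inr is \<Rightarrow> F_op (wedge_list is) (last is))"


section \<open>Linear extension and the wedge product\<close>

lemma scale_eq: "scale c x = (if c = 0 then 0 else x)"
  by (cases c) (auto simp: scale_def poly_mapping_eq_iff fun_eq_iff Poly_Mapping.map.rep_eq when_def)

lemma add_self_eq_0 [simp]: "(x :: 'a \<Rightarrow>\<^sub>0 bit) + x = 0"
  by (rule poly_mapping_eqI) (simp add: lookup_add)

lemma uminus_eq_self [simp]: "- (x :: 'a \<Rightarrow>\<^sub>0 bit) = x"
  by (simp add: minus_unique)

lemma lin_ext_zero [simp]: "lin_ext f 0 = 0"
  by (simp add: lin_ext_def)

lemma lin_ext_single [simp]: "lin_ext f (Poly_Mapping.single a 1) = f a"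
  by (simp add: lin_ext_def scale_eq)

lemma lin_ext_monomial [simp]: "lin_ext f (monomial I) = f I"
  by (simp add: monomial_def)

lemma lin_ext_add: "lin_ext f (x + y) = lin_ext f x + lin_ext f y"
proof -
  have add: "scale (c + d) z = scale c z + scale d z" for c d and z :: "'b \<Rightarrow>\<^sub>0 bit"
    by (cases c; cases d) (auto simp: scale_eq)
  show ?thesis
    unfolding lin_ext_def
    by (rule setsum_keys_plus_distrib[where f = "\<lambda>a c. scale c (f a)"]) (simp_all add: add scale_eq)
qed

lemma lin_ext_fun_add: "lin_ext (\<lambda>a. f a + g a) x = lin_ext f x + lin_ext g x"
  by (simp add: lin_ext_def scale_eq sum.distrib[symmetric] if_distrib cong: if_cong)

lemma lin_ext_sum: "lin_ext f (sum g A) = (\<Sum>a\<in>A. lin_ext f (g a))"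
  by (induction A rule: infinite_finite_induct) (simp_all add: lin_ext_add)

lemma pm_eq_sum: "x = (\<Sum>a\<in>Poly_Mapping.keys x. Poly_Mapping.single a (1 :: bit))"
proof (rule poly_mapping_eqI)
  fix k
  have "(\<Sum>a\<in>Poly_Mapping.keys x. Poly_Mapping.lookup (Poly_Mapping.single a 1) k)
        = (\<Sum>a\<in>Poly_Mapping.keys x. if a = k then (1 :: bit) else 0)"
    by (rule sum.cong) (auto simp: lookup_single when_def)
  then show "Poly_Mapping.lookup x k =
      Poly_Mapping.lookup (\<Sum>a\<in>Poly_Mapping.keys x. Poly_Mapping.single a (1 :: bit)) k"
    by (auto simp: lookup_sum in_keys_iff)
qed

lemma pm_induct [case_names zero single add]:
  assumes "P 0" and "\<And>a. a \<in> Poly_Mapping.keys x \<Longrightarrow> P (Poly_Mapping.single a (1 :: bit))"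
    and "\<And>y z. P y \<Longrightarrow> P z \<Longrightarrow> P (y + z)"
  shows "P x"
proof -
  have "A \<subseteq> Poly_Mapping.keys x \<Longrightarrow> P (\<Sum>a\<in>A. Poly_Mapping.single a (1 :: bit))" for A
    by (induction A rule: infinite_finite_induct) (simp_all add: assms)
  from this[of "Poly_Mapping.keys x"] show ?thesis
    using pm_eq_sum[of x] by simp
qed

lemma form_induct [case_names zero monomial add]:
  assumes "P 0" and "\<And>I. I \<in> Poly_Mapping.keys \<omega> \<Longrightarrow> P (monomial I)"
    and "\<And>\<eta> \<theta>. P \<eta> \<Longrightarrow> P \<theta> \<Longrightarrow> P (\<eta> + \<theta>)"
  shows "P \<omega>"
  by (rule pm_induct[of P \<omega>]) (use assms in \<open>auto simp: monomial_def\<close>)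

lemma wedge_zero [simp]: "0 \<and>\<^sub>f \<eta> = 0" "\<omega> \<and>\<^sub>f 0 = 0"
  by (simp_all add: wedge_def lin_ext_def scale_eq)

lemma wedge_add_left: "(\<omega> + \<omega>') \<and>\<^sub>f \<eta> = \<omega> \<and>\<^sub>f \<eta> + \<omega>' \<and>\<^sub>f \<eta>"
  by (simp add: wedge_def lin_ext_add)

lemma wedge_add_right: "\<omega> \<and>\<^sub>f (\<eta> + \<eta>') = \<omega> \<and>\<^sub>f \<eta> + \<omega> \<and>\<^sub>f \<eta>'"
  by (simp add: wedge_def lin_ext_add lin_ext_fun_add)

lemmas wedge_add = wedge_add_left wedge_add_right

lemma wedge_monomial:
  "monomial I \<and>\<^sub>f monomial J = (if I \<inter> J = {} then monomial (I \<union> J) else 0)"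
  by (simp add: wedge_def)

lemma wedge_sum_left: "(\<Sum>a\<in>A. f a) \<and>\<^sub>f \<eta> = (\<Sum>a\<in>A. f a \<and>\<^sub>f \<eta>)"
  by (induction A rule: infinite_finite_induct) (simp_all add: wedge_add)

lemma wedge_sum_right: "\<omega> \<and>\<^sub>f (\<Sum>a\<in>A. f a) = (\<Sum>a\<in>A. \<omega> \<and>\<^sub>f f a)"
  by (induction A rule: infinite_finite_induct) (simp_all add: wedge_add)

lemma wedge_commute: "\<omega> \<and>\<^sub>f \<eta> = \<eta> \<and>\<^sub>f \<omega>"
proof (induction \<omega> rule: form_induct)
  case (monomial I)
  show ?case
    by (induction \<eta> rule: form_induct) (auto simp: wedge_monomial wedge_add Un_commute)
qed (simp_all add: wedge_add)

lemma wedge_assoc: "(\<omega> \<and>\<^sub>f \<eta>) \<and>\<^sub>f \<theta> = \<omega> \<and>\<^sub>f (\<eta> \<and>\<^sub>f \<theta>)"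
proof (induction \<omega> rule: form_induct)
  case (monomial I)
  show ?case
  proof (induction \<eta> rule: form_induct)
    case (monomial J)
    show ?case
      by (induction \<theta> rule: form_induct)
         (auto simp: wedge_monomial wedge_add Un_assoc Int_Un_distrib Int_Un_distrib2)
  qed (simp_all add: wedge_add)
qed (simp_all add: wedge_add)

lemma wedge_left_commute: "\<omega> \<and>\<^sub>f (\<eta> \<and>\<^sub>f \<theta>) = \<eta> \<and>\<^sub>f (\<omega> \<and>\<^sub>f \<theta>)"
  by (metis wedge_assoc wedge_commute)

lemmas wedge_ac = wedge_assoc wedge_commute wedge_left_commute

lemma wedge_one [simp]: "monomial {} \<and>\<^sub>f \<omega> = \<omega>" "\<omega> \<and>\<^sub>f monomial {} = \<omega>"
proof -
  show "monomial {} \<and>\<^sub>f \<omega> = \<omega>"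
    by (induction \<omega> rule: form_induct) (simp_all add: wedge_monomial wedge_add)
  then show "\<omega> \<and>\<^sub>f monomial {} = \<omega>"
    by (simp add: wedge_commute)
qed

lemma exterior_algebra_closed [simp, intro]:
  "0 \<in> exterior_algebra"
  "\<omega> \<in> exterior_algebra \<Longrightarrow> \<eta> \<in> exterior_algebra \<Longrightarrow> \<omega> + \<eta> \<in> exterior_algebra"
  "finite I \<Longrightarrow> 0 \<notin> I \<Longrightarrow> monomial I \<in> exterior_algebra"
  using Poly_Mapping.keys_add[of \<omega> \<eta>]
  by (auto simp: exterior_algebra_def monomial_def Suc_le_eq intro!: gr0I)

lemma exterior_power_closed [simp, intro]:
  "0 \<in> exterior_power q"
  "\<omega> \<in> exterior_power q \<Longrightarrow> \<eta> \<in> exterior_power q \<Longrightarrow> \<omega> + \<eta> \<in> exterior_power q"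
  "finite I \<Longrightarrow> 0 \<notin> I \<Longrightarrow> card I = q \<Longrightarrow> monomial I \<in> exterior_power q"
  using Poly_Mapping.keys_add[of \<omega> \<eta>]
  by (auto simp: exterior_power_def) (auto simp: monomial_def)

lemma exterior_power_subset: "exterior_power q \<subseteq> exterior_algebra"
  by (auto simp: exterior_power_def)

lemma exterior_algebra_sum:
  "(\<And>a. a \<in> A \<Longrightarrow> f a \<in> exterior_algebra) \<Longrightarrow> sum f A \<in> exterior_algebra"
  by (induction A rule: infinite_finite_induct) auto

lemma exterior_power_sum:
  "(\<And>a. a \<in> A \<Longrightarrow> f a \<in> exterior_power q) \<Longrightarrow> sum f A \<in> exterior_power q"
  by (induction A rule: infinite_finite_induct) auto

lemma exterior_algebra_induct [consumes 1, case_names zero monomial add]: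
  assumes "\<omega> \<in> exterior_algebra" and "P 0"
    and "\<And>I. finite I \<Longrightarrow> 0 \<notin> I \<Longrightarrow> P (monomial I)"
    and "\<And>\<eta> \<theta>. P \<eta> \<Longrightarrow> P \<theta> \<Longrightarrow> P (\<eta> + \<theta>)"
  shows "P \<omega>"
  by (rule form_induct[of P \<omega>])
     (use assms in \<open>force simp: exterior_algebra_def\<close>)+

lemma exterior_power_induct [consumes 1, case_names zero monomial add]:
  assumes "\<omega> \<in> exterior_power q" and "P 0"
    and "\<And>I. finite I \<Longrightarrow> 0 \<notin> I \<Longrightarrow> card I = q \<Longrightarrow> P (monomial I)"
    and "\<And>\<eta> \<theta>. P \<eta> \<Longrightarrow> P \<theta> \<Longrightarrow> P (\<eta> + \<theta>)"
  shows "P \<omega>"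
  by (rule form_induct[of P \<omega>])
     (use assms in \<open>force simp: exterior_algebra_def exterior_power_def\<close>)+

lemma exterior_power_wedge:
  assumes "\<omega> \<in> exterior_power p" and "\<eta> \<in> exterior_power q"
  shows "\<omega> \<and>\<^sub>f \<eta> \<in> exterior_power (p + q)"
  using assms(1)
proof (induction \<omega> rule: exterior_power_induct)
  case (monomial I)
  with assms(2) show ?case
    by (induction \<eta> rule: exterior_power_induct)
       (auto simp: wedge_monomial wedge_add card_Un_disjoint)
qed (auto simp: wedge_add)

lemma exterior_algebra_wedge:
  assumes "\<omega> \<in> exterior_algebra" and "\<eta> \<in> exterior_algebra"
  shows "\<omega> \<and>\<^sub>f \<eta> \<in> exterior_algebra"
  using assms(1)
proof (induction \<omega> rule: exterior_algebra_induct)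
  case (monomial I)
  with assms(2) show ?case
    by (induction \<eta> rule: exterior_algebra_induct) (auto simp: wedge_monomial wedge_add)
qed (auto simp: wedge_add)

lemma wedge_list_eq:
  "sorted_wrt (<) is \<Longrightarrow> wedge_list is = monomial (set is)"
  by (induction "is") (auto simp: wedge_list_def wedge_monomial)


section \<open>Derivations\<close>

lemma derivation_zero [simp]: "derivation \<delta> 0 = 0"
  by (simp add: derivation_def)

lemma derivation_add: "derivation \<delta> (\<omega> + \<eta>) = derivation \<delta> \<omega> + derivation \<delta> \<eta>"
  by (simp add: derivation_def lin_ext_add)

lemma derivation_monomial:
  "derivation \<delta> (monomial I) = (\<Sum>k\<in>I. \<delta> k \<and>\<^sub>f monomial (I - {k}))"
  by (simp add: derivation_def)

lemma derivation_e [simp]: "derivation \<delta> (dual_basis k) = \<delta> k"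
  by (simp add: derivation_monomial)

lemma derivation_wedge_monomial:
  assumes "finite I" and "finite J"
  shows "derivation \<delta> (monomial I \<and>\<^sub>f monomial J)
    = derivation \<delta> (monomial I) \<and>\<^sub>f monomial J + monomial I \<and>\<^sub>f derivation \<delta> (monomial J)"
proof -
  let ?L = "\<lambda>k. \<delta> k \<and>\<^sub>f (monomial (I - {k}) \<and>\<^sub>f monomial J)"
  let ?R = "\<lambda>k. \<delta> k \<and>\<^sub>f (monomial I \<and>\<^sub>f monomial (J - {k}))"
  have eq: "derivation \<delta> (monomial I) \<and>\<^sub>f monomial J + monomial I \<and>\<^sub>f derivation \<delta> (monomial J)
    = sum ?L I + sum ?R J"
    by (simp add: derivation_monomial wedge_sum_left wedge_sum_right wedge_assoc
        wedge_left_commute[of "monomial I"])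
  show ?thesis
  proof (cases "I \<inter> J = {}")
    case True
    have "sum ?L I = (\<Sum>k\<in>I. \<delta> k \<and>\<^sub>f monomial (I \<union> J - {k}))"
    proof (intro sum.cong refl)
      fix k assume "k \<in> I"
      then have "(I - {k}) \<inter> J = {}" and "(I - {k}) \<union> J = I \<union> J - {k}"
        using True by auto
      then show "?L k = \<delta> k \<and>\<^sub>f monomial (I \<union> J - {k})"
        by (simp add: wedge_monomial)
    qed
    moreover have "sum ?R J = (\<Sum>k\<in>J. \<delta> k \<and>\<^sub>f monomial (I \<union> J - {k}))"
    proof (intro sum.cong refl)
      fix k assume "k \<in> J"
      then have "I \<inter> (J - {k}) = {}" and "I \<union> (J - {k}) = I \<union> J - {k}"
        using True by auto
      then show "?R k = \<delta> k \<and>\<^sub>f monomial (I \<union> J - {k})"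
        by (simp add: wedge_monomial)
    qed
    ultimately show ?thesis
      unfolding eq using True assms
      by (simp add: wedge_monomial derivation_monomial sum.union_disjoint)
  next
    case False
    have zero: "monomial (I - {k}) \<and>\<^sub>f monomial J = 0" if "k \<notin> J" for k
      using False that by (auto simp: wedge_monomial)
    have zero': "monomial I \<and>\<^sub>f monomial (J - {k}) = 0" if "k \<notin> I" for k
      using False that by (auto simp: wedge_monomial)
    have "sum ?L I = sum ?L (I \<inter> J)"
      using assms by (intro sum.mono_neutral_right) (auto simp: zero)
    moreover have "sum ?R J = sum ?R (I \<inter> J)"
    proof (intro sum.mono_neutral_right ballI)
      fix k assume "k \<in> J - I \<inter> J"
      then have "k \<notin> I" by blast
      then show "?R k = 0" by (simp add: zero')
    qed (use assms in auto)
    moreover have "sum ?L (I \<inter> J) = sum ?R (I \<inter> J)"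
    proof (intro sum.cong refl)
      fix k assume k: "k \<in> I \<inter> J"
      have "(I - {k}) \<inter> J = I \<inter> (J - {k})" and "(I - {k}) \<union> J = I \<union> (J - {k})"
        using k by auto
      then show "?L k = ?R k"
        by (simp add: wedge_monomial)
    qed
    ultimately show ?thesis
      unfolding eq using False by (simp add: wedge_monomial)
  qed
qed

lemma derivation_wedge:
  assumes "\<omega> \<in> exterior_algebra" and "\<eta> \<in> exterior_algebra"
  shows "derivation \<delta> (\<omega> \<and>\<^sub>f \<eta>) = derivation \<delta> \<omega> \<and>\<^sub>f \<eta> + \<omega> \<and>\<^sub>f derivation \<delta> \<eta>"
  using assms(1)
proof (induction \<omega> rule: exterior_algebra_induct)
  case (monomial I)
  from assms(2) show ?case
  proof (induction \<eta> rule: exterior_algebra_induct)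
    case (monomial J)
    then show ?case
      using \<open>finite I\<close> by (simp add: derivation_wedge_monomial)
  qed (simp_all add: wedge_add derivation_add add_ac)
qed (simp_all add: wedge_add derivation_add add_ac)

lemma derivation_power:
  assumes "\<omega> \<in> exterior_power q" and "\<And>k. 1 \<le> k \<Longrightarrow> \<delta> k \<in> exterior_power (Suc r)"
  shows "derivation \<delta> \<omega> \<in> exterior_power (q + r)"
  using assms(1)
proof (induction \<omega> rule: exterior_power_induct)
  case (monomial I)
  have "\<delta> k \<and>\<^sub>f monomial (I - {k}) \<in> exterior_power (q + r)" if "k \<in> I" for k
  proof -
    have "1 \<le> k" using that monomial by (cases k) auto
    moreover have "monomial (I - {k}) \<in> exterior_power (q - 1)"
      using monomial that by (intro exterior_power_closed) auto
    ultimately have "\<delta> k \<and>\<^sub>f monomial (I - {k}) \<in> exterior_power (Suc r + (q - 1))"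
      using assms(2) exterior_power_wedge by blast
    moreover have "0 < q" using monomial that by (auto simp: card_gt_0_iff)
    ultimately show ?thesis by (simp add: add.commute)
  qed
  then show ?case
    by (auto simp: derivation_monomial intro: exterior_power_sum)
qed (auto simp: derivation_add)


section \<open>The differentials of the two Lie algebras\<close>

lemma lookup_m0:
  "i < j \<Longrightarrow> Poly_Mapping.lookup (m0 i j) k = (if i = 1 \<and> k = j + 1 then 1 else 0)"
  by (auto simp: m0_def lookup_single when_def)

lemma lookup_m2:
  assumes "i < j"
  shows "Poly_Mapping.lookup (m2 i j) k =
    (if i = 1 \<and> k = j + 1 \<or> i = 2 \<and> 2 < j \<and> k = j + 2 then 1 else 0)"
proof -
  consider (0) "i = 0" | (1) "i = 1" | (2) "i = 2" | (3) "2 < i" by linarith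
  then show ?thesis
    by cases (use assms in \<open>auto simp: m2_def lookup_single when_def\<close>)
qed

lemma lie_diff_e_m0:
  "lie_diff m0 (dual_basis k) = (if 2 < k then dual_basis 1 \<and>\<^sub>f dual_basis (k - 1) else 0)"
proof -
  note l = lookup_m0
  have "{(i, j). 1 \<le> i \<and> i < j \<and> Poly_Mapping.lookup (m0 i j) k \<noteq> 0}
        = (if 2 < k then {(1, k - 1)} else {})" (is "?S = ?T")
  proof (rule Set.set_eqI)
    fix p :: "nat \<times> nat"
    obtain i j where [simp]: "p = (i, j)" by (cases p)
    have "p \<in> ?S \<longleftrightarrow> 1 \<le> i \<and> i < j \<and> i = 1 \<and> k = j + 1"
      using l[of i j k] by (auto split: if_splits)
    also have "\<dots> \<longleftrightarrow> i = 1 \<and> j = k - 1 \<and> 2 < k"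
      by linarith
    also have "\<dots> \<longleftrightarrow> p \<in> ?T" by simp
    finally show "p \<in> ?S \<longleftrightarrow> p \<in> ?T" .
  qed
  moreover have "Poly_Mapping.lookup (m0 1 (k - 1)) k = 1" if "2 < k"
    using that l[of 1 "k - 1" k] by simp
  ultimately show ?thesis
    by (simp add: lie_diff_def lie_diff_dual_def scale_eq)
qed

lemma lie_diff_e_m2:
  "lie_diff m2 (dual_basis k) =
     (if 2 < k then dual_basis 1 \<and>\<^sub>f dual_basis (k - 1) else 0)
   + (if 4 < k then dual_basis 2 \<and>\<^sub>f dual_basis (k - 2) else 0)"
proof -
  note l = lookup_m2
  have "{(i, j). 1 \<le> i \<and> i < j \<and> Poly_Mapping.lookup (m2 i j) k \<noteq> 0}
        = (if 2 < k then {(1, k - 1)} else {}) \<union> (if 4 < k then {(2, k - 2)} else {})"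
    (is "?S = ?T")
  proof (rule Set.set_eqI)
    fix p :: "nat \<times> nat"
    obtain i j where [simp]: "p = (i, j)" by (cases p)
    have "p \<in> ?S \<longleftrightarrow> 1 \<le> i \<and> i < j \<and> (i = 1 \<and> k = j + 1 \<or> i = 2 \<and> 2 < j \<and> k = j + 2)"
      using l[of i j k] by (auto split: if_splits)
    also have "\<dots> \<longleftrightarrow> i = 1 \<and> j = k - 1 \<and> 2 < k \<or> i = 2 \<and> j = k - 2 \<and> 4 < k"
      by linarith
    also have "\<dots> \<longleftrightarrow> p \<in> ?T" by simp
    finally show "p \<in> ?S \<longleftrightarrow> p \<in> ?T" .
  qed
  moreover have "Poly_Mapping.lookup (m2 1 (k - 1)) k = 1" if "2 < k"
    using that l[of 1 "k - 1" k] by simp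
  moreover have "Poly_Mapping.lookup (m2 2 (k - 2)) k = 1" if "4 < k"
    using that l[of 2 "k - 2" k] by simp
  ultimately show ?thesis
    by (simp add: lie_diff_def lie_diff_dual_def scale_eq)
qed

text \<open>Evaluation of one- and two-forms, with \<open>(e\<^sup>i \<and> e\<^sup>j) (X, Y) = x\<^sub>i y\<^sub>j + x\<^sub>j y\<^sub>i\<close>.\<close>

definition eval1 :: "form \<Rightarrow> vec \<Rightarrow> bit" where
  "eval1 \<xi> X = (\<Sum>i\<in>Poly_Mapping.keys X. Poly_Mapping.lookup \<xi> {i} * Poly_Mapping.lookup X i)"

definition eval2 :: "form \<Rightarrow> vec \<Rightarrow> vec \<Rightarrow> bit" where
  "eval2 \<omega> X Y = (\<Sum>i\<in>Poly_Mapping.keys X. (\<Sum>j\<in>Poly_Mapping.keys Y.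
     (if i = j then 0 else Poly_Mapping.lookup \<omega> {i, j}) * Poly_Mapping.lookup Y j) * Poly_Mapping.lookup X i)"

lemma eval1_add: "eval1 (\<xi> + \<xi>') X = eval1 \<xi> X + eval1 \<xi>' X"
    "eval1 \<xi> (X + Y) = eval1 \<xi> X + eval1 \<xi> Y"
proof -
  show "eval1 (\<xi> + \<xi>') X = eval1 \<xi> X + eval1 \<xi>' X"
    by (simp only: eval1_def lookup_add distrib_right sum.distrib)
  show "eval1 \<xi> (X + Y) = eval1 \<xi> X + eval1 \<xi> Y"
    unfolding eval1_def
    by (rule setsum_keys_plus_distrib[where f = "\<lambda>i c. Poly_Mapping.lookup \<xi> {i} * c"])
       (simp_all only: mult_zero_right distrib_left)
qed

lemma eval1_zero [simp]: "eval1 0 X = 0" "eval1 \<xi> 0 = 0"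
  by (simp_all add: eval1_def)

lemma eval2_add: "eval2 (\<omega> + \<omega>') X Y = eval2 \<omega> X Y + eval2 \<omega>' X Y"
    "eval2 \<omega> (X + X') Y = eval2 \<omega> X Y + eval2 \<omega> X' Y"
    "eval2 \<omega> X (Y + Y') = eval2 \<omega> X Y + eval2 \<omega> X Y'"
proof -
  have "(if i = j then 0 else Poly_Mapping.lookup (\<omega> + \<omega>') {i, j})
    = (if i = j then 0 else Poly_Mapping.lookup \<omega> {i, j})
      + (if i = j then 0 else Poly_Mapping.lookup \<omega>' {i, j})" for i j :: nat
    by (simp add: lookup_add)
  then show "eval2 (\<omega> + \<omega>') X Y = eval2 \<omega> X Y + eval2 \<omega>' X Y"
    by (simp only: eval2_def distrib_right sum.distrib)
  show "eval2 \<omega> (X + X') Y = eval2 \<omega> X Y + eval2 \<omega> X' Y"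
    unfolding eval2_def
    by (rule setsum_keys_plus_distrib[where f = "\<lambda>i c. (\<Sum>j\<in>Poly_Mapping.keys Y.
          (if i = j then 0 else Poly_Mapping.lookup \<omega> {i, j}) * Poly_Mapping.lookup Y j) * c"])
       (simp_all only: mult_zero_right distrib_left)
  have "(\<Sum>j\<in>Poly_Mapping.keys (Y + Y').
          (if i = j then 0 else Poly_Mapping.lookup \<omega> {i, j}) * Poly_Mapping.lookup (Y + Y') j)
      = (\<Sum>j\<in>Poly_Mapping.keys Y.
          (if i = j then 0 else Poly_Mapping.lookup \<omega> {i, j}) * Poly_Mapping.lookup Y j)
      + (\<Sum>j\<in>Poly_Mapping.keys Y'.
          (if i = j then 0 else Poly_Mapping.lookup \<omega> {i, j}) * Poly_Mapping.lookup Y' j)" for i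
    by (rule setsum_keys_plus_distrib[where
          f = "\<lambda>j c. (if i = j then 0 else Poly_Mapping.lookup \<omega> {i, j}) * c"])
       (simp_all only: mult_zero_right distrib_left)
  then show "eval2 \<omega> X (Y + Y') = eval2 \<omega> X Y + eval2 \<omega> X Y'"
    by (simp only: eval2_def distrib_right sum.distrib)
qed

lemma eval2_zero [simp]: "eval2 0 X Y = 0" "eval2 \<omega> 0 Y = 0" "eval2 \<omega> X 0 = 0"
  by (simp_all only: eval2_def lookup_zero if_cancel mult_zero_left sum.neutral_const keys_zero sum.empty)

lemma bracket_add:
  "bracket \<gg> (X + X') Y = bracket \<gg> X Y + bracket \<gg> X' Y"
  "bracket \<gg> X (Y + Y') = bracket \<gg> X Y + bracket \<gg> X Y'"
  by (simp_all add: bracket_def lin_ext_add lin_ext_fun_add)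

lemma bracket_basis [simp]: "bracket \<gg> (basis_vec i) (basis_vec j) = \<gg> i j"
  by (simp add: bracket_def)

lemma bracket_zero [simp]: "bracket \<gg> 0 Y = 0" "bracket \<gg> X 0 = 0"
  by (simp_all add: bracket_def lin_ext_def scale_eq)

lemma eval2_lie_diff:
  assumes "\<gg> \<in> {m0, m2}" and "\<xi> \<in> exterior_power 1"
  shows "eval2 (lie_diff \<gg> \<xi>) X Y = eval1 \<xi> (bracket \<gg> X Y)"
  using assms(2)
proof (induction \<xi> rule: exterior_power_induct)
  case zero
  then show ?case by (simp add: lie_diff_def)
next
  case (add \<eta> \<theta>)
  then show ?case by (simp add: lie_diff_def derivation_add eval1_add eval2_add)
next
  case (monomial I)
  then obtain k where [simp]: "I = {k}" by (auto simp: card_Suc_eq)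
  have keys: "Poly_Mapping.keys (basis_vec i) = {i}" for i
    by simp
  have sum: "(\<Sum>x\<in>{i}. f x) = f i" for f :: "nat \<Rightarrow> bit" and i
    by simp
  note single = keys sum lookup_single_eq mult_1_right
  have s: "eval1 (dual_basis k) (basis_vec i) = Poly_Mapping.lookup (basis_vec i) k" for i
    unfolding eval1_def single by (auto simp: monomial_def lookup_single when_def)
  have e1: "eval1 (dual_basis k) Z = Poly_Mapping.lookup Z k" for Z
    by (induction Z rule: pm_induct) (simp_all add: eval1_add lookup_add s)
  have e2: "eval2 \<omega> (basis_vec i) (basis_vec j) = (if i = j then 0 else Poly_Mapping.lookup \<omega> {i, j})"
    for \<omega> i j unfolding eval2_def single by (rule refl)
  have less: "Poly_Mapping.lookup (lie_diff \<gg> (dual_basis k)) {i, j} = Poly_Mapping.lookup (\<gg> i j) k"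
    if "i < j" for i j
  proof -
    have lm: "Poly_Mapping.lookup (monomial S) T = (if S = T then 1 else 0)" for S T
      by (simp add: monomial_def lookup_single when_def)
    have w1: "Poly_Mapping.lookup (dual_basis 1 \<and>\<^sub>f dual_basis (k - 1)) {i, j}
        = (if i = 1 \<and> k = j + 1 then 1 else 0)" if "2 < k"
    proof -
      have "{1} \<inter> {k - 1} = {}" and "{1, k - 1} = {i, j} \<longleftrightarrow> i = 1 \<and> k = j + 1"
        using \<open>i < j\<close> that by (auto simp: doubleton_eq_iff)
      then show ?thesis by (simp only: wedge_monomial lm simp_thms if_True insert_is_Un[symmetric])
    qed
    have w2: "Poly_Mapping.lookup (dual_basis 2 \<and>\<^sub>f dual_basis (k - 2)) {i, j}
        = (if i = 2 \<and> k = j + 2 then 1 else 0)" if "4 < k"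
    proof -
      have "{2} \<inter> {k - 2} = {}" and "{2, k - 2} = {i, j} \<longleftrightarrow> i = 2 \<and> k = j + 2"
        using \<open>i < j\<close> that by (auto simp: doubleton_eq_iff)
      then show ?thesis by (simp only: wedge_monomial lm simp_thms if_True insert_is_Un[symmetric])
    qed
    consider "\<gg> = m0" | "\<gg> = m2" using assms(1) by blast
    then show ?thesis
    proof cases
      case 1
      then show ?thesis
        using \<open>i < j\<close> w1 by (cases "2 < k") (simp_all add: lie_diff_e_m0 lookup_m0)
    next
      case 2
      then show ?thesis
        using \<open>i < j\<close> w1 w2
        by (cases "2 < k"; cases "4 < k") (simp_all add: lie_diff_e_m2 lookup_m2 lookup_add)
    qed
  qed
  have sym: "\<gg> i j = \<gg> j i" and alt: "\<gg> i i = 0" for i j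
    using assms(1) by (auto simp: m0_def m2_def)
  have base: "eval2 (lie_diff \<gg> (dual_basis k)) (basis_vec i) (basis_vec j)
    = eval1 (dual_basis k) (\<gg> i j)" for i j
    using less[of i j] less[of j i] sym[of i j] alt[of i] unfolding e1 e2
    by (cases i j rule: linorder_cases) (simp_all add: insert_commute)
  show ?case
  proof (induction X rule: pm_induct)
    case (single i)
    show ?case
      by (induction Y rule: pm_induct) (simp_all add: base eval1_add eval2_add bracket_add)
  qed (simp_all add: eval1_add eval2_add bracket_add)
qed

lemma lie_diff_power:
  assumes "\<gg> \<in> {m0, m2}" and "\<omega> \<in> exterior_power q"
  shows "lie_diff \<gg> \<omega> \<in> exterior_power (Suc q)"
proof -
  have e: "lie_diff_dual \<gg> k = lie_diff \<gg> (dual_basis k)" for k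
    by (simp add: lie_diff_def)
  have "lie_diff_dual \<gg> k \<in> exterior_power (Suc 1)" if "1 \<le> k" for k
    using assms(1) unfolding e
    by (auto simp: lie_diff_e_m0 lie_diff_e_m2 wedge_monomial)
  from derivation_power[OF assms(2) this] show ?thesis
    by (simp add: lie_diff_def)
qed

lemma lie_diff_exterior_algebra:
  assumes "\<gg> \<in> {m0, m2}" and "\<omega> \<in> exterior_algebra"
  shows "lie_diff \<gg> \<omega> \<in> exterior_algebra"
  using assms(2)
proof (induction \<omega> rule: exterior_algebra_induct)
  case (monomial I)
  then show ?case
    using lie_diff_power[OF assms(1), of "monomial I" "card I"] exterior_power_subset by auto
qed (auto simp: lie_diff_def derivation_add)

lemma lie_diff_wedge:
  "\<omega> \<in> exterior_algebra \<Longrightarrow> \<eta> \<in> exterior_algebra \<Longrightarrow>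
    lie_diff \<gg> (\<omega> \<and>\<^sub>f \<eta>) = lie_diff \<gg> \<omega> \<and>\<^sub>f \<eta> + \<omega> \<and>\<^sub>f lie_diff \<gg> \<eta>"
  by (simp add: lie_diff_def derivation_wedge)

lemma lie_diff_add: "lie_diff \<gg> (\<omega> + \<eta>) = lie_diff \<gg> \<omega> + lie_diff \<gg> \<eta>"
  by (simp add: lie_diff_def derivation_add)

lemma lie_diff_zero [simp]: "lie_diff \<gg> 0 = 0"
  by (simp add: lie_diff_def)

lemma lie_diff_one [simp]: "lie_diff \<gg> (monomial {}) = 0"
  by (simp add: lie_diff_def derivation_monomial)

lemma lie_diff_lie_diff_e:
  assumes "\<gg> \<in> {m0, m2}" and "1 \<le> k"
  shows "lie_diff \<gg> (lie_diff \<gg> (dual_basis k)) = 0"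
proof -
  have w: "lie_diff \<hh> (dual_basis i \<and>\<^sub>f dual_basis j)
      = lie_diff \<hh> (dual_basis i) \<and>\<^sub>f dual_basis j + dual_basis i \<and>\<^sub>f lie_diff \<hh> (dual_basis j)"
    if "1 \<le> i" "1 \<le> j" for i j \<hh>
    using that by (intro lie_diff_wedge exterior_algebra_closed) auto
  have w1: "dual_basis i \<and>\<^sub>f (dual_basis i \<and>\<^sub>f \<eta>) = 0" for i \<eta>
    by (simp add: wedge_assoc[symmetric] wedge_monomial[of "{i}" "{i}"])
  consider "k \<le> 2" | "k = 3" | "k = 4" | "k = 5" | "5 < k" by linarith
  then have "lie_diff m0 (lie_diff m0 (dual_basis k)) = 0
    \<and> lie_diff m2 (lie_diff m2 (dual_basis k)) = 0"
  proof cases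
    case 5
    have "dual_basis 2 \<and>\<^sub>f (dual_basis 1 \<and>\<^sub>f dual_basis (k - 3))
        = dual_basis 1 \<and>\<^sub>f (dual_basis 2 \<and>\<^sub>f dual_basis (k - 3))"
      by (rule wedge_left_commute)
    moreover obtain m where "k = m + 6"
      using 5 that[of "k - 6"] by simp
    ultimately show ?thesis
      using w1[of 1] w1[of 2] by (simp add: w lie_diff_e_m0 lie_diff_e_m2 lie_diff_add wedge_add)
  qed (use w1[of 1] w1[of 2] wedge_left_commute[of "dual_basis 2" "dual_basis 1" "dual_basis 2"]
         wedge_monomial[of "{2}" "{2}"]
       in \<open>simp_all add: w lie_diff_e_m0 lie_diff_e_m2 lie_diff_add wedge_add\<close>)
  with assms(1) show ?thesis by auto
qed

lemma lie_diff_lie_diff: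
  assumes "\<gg> \<in> {m0, m2}" and "\<omega> \<in> exterior_algebra"
  shows "lie_diff \<gg> (lie_diff \<gg> \<omega>) = 0"
  using assms(2)
proof (induction \<omega> rule: exterior_algebra_induct)
  case (monomial I)
  then show ?case
  proof (induction I rule: finite_induct)
    case (insert k I)
    have mem: "dual_basis k \<in> exterior_algebra" "monomial I \<in> exterior_algebra"
      using insert by auto
    have k: "1 \<le> k" using insert by (cases k) auto
    have "monomial (insert k I) = dual_basis k \<and>\<^sub>f monomial I"
      using insert by (simp add: wedge_monomial)
    with mem k insert show ?case
      by (simp add: lie_diff_wedge lie_diff_add lie_diff_exterior_algebra[OF assms(1)]
          lie_diff_lie_diff_e[OF assms(1)])
  qed simp
qed (simp_all add: lie_diff_add)


section \<open>The cohomology algebras\<close>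

lemma cocycle_ring_cring: "cring (cocycle_ring \<gg>)"
proof (intro cringI abelian_groupI comm_monoidI)
  fix x assume "x \<in> carrier (cocycle_ring \<gg>)"
  then show "\<exists>y\<in>carrier (cocycle_ring \<gg>). y \<oplus>\<^bsub>cocycle_ring \<gg>\<^esub> x = \<zero>\<^bsub>cocycle_ring \<gg>\<^esub>"
    by (intro bexI[of _ x]) (simp_all add: cocycle_ring_def)
qed (auto simp: cocycle_ring_def cocycles_def lie_diff_add lie_diff_wedge exterior_algebra_wedge
    wedge_assoc wedge_add add.assoc intro: wedge_commute add.commute)

lemma coboundaries_subset: "\<gg> \<in> {m0, m2} \<Longrightarrow> coboundaries \<gg> \<subseteq> cocycles \<gg>"
  using lie_diff_exterior_algebra lie_diff_lie_diff by (auto simp: coboundaries_def cocycles_def)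

lemma coboundaries_ideal:
  assumes "\<gg> \<in> {m0, m2}"
  shows "ideal (coboundaries \<gg>) (cocycle_ring \<gg>)"
proof -
  interpret cring "cocycle_ring \<gg>" by (rule cocycle_ring_cring)
  have minus: "\<ominus>\<^bsub>cocycle_ring \<gg>\<^esub> x = x" if "x \<in> cocycles \<gg>" for x
    using that by (intro minus_equality) (auto simp: cocycle_ring_def)
  have mult: "\<eta> \<and>\<^sub>f lie_diff \<gg> \<omega> \<in> coboundaries \<gg>"
    if "\<omega> \<in> exterior_algebra" and "\<eta> \<in> cocycles \<gg>" for \<omega> \<eta>
  proof -
    have "\<eta> \<and>\<^sub>f lie_diff \<gg> \<omega> = lie_diff \<gg> (\<eta> \<and>\<^sub>f \<omega>)"
      using that by (simp add: lie_diff_wedge cocycles_def)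
    then show ?thesis
      using that by (auto simp: coboundaries_def cocycles_def exterior_algebra_wedge)
  qed
  show ?thesis
  proof (rule idealI)
    show "subgroup (coboundaries \<gg>) (add_monoid (cocycle_ring \<gg>))"
    proof (rule add.subgroupI)
      show "coboundaries \<gg> \<subseteq> carrier (cocycle_ring \<gg>)"
        using coboundaries_subset[OF assms] by (simp add: cocycle_ring_def)
      show "coboundaries \<gg> \<noteq> {}"
        by (auto simp: coboundaries_def)
      show "\<ominus>\<^bsub>cocycle_ring \<gg>\<^esub> a \<in> coboundaries \<gg>" if "a \<in> coboundaries \<gg>" for a
        using that minus coboundaries_subset[OF assms] by auto
      show "a \<oplus>\<^bsub>cocycle_ring \<gg>\<^esub> b \<in> coboundaries \<gg>"
        if "a \<in> coboundaries \<gg>" "b \<in> coboundaries \<gg>" for a b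
        using that by (auto simp: cocycle_ring_def coboundaries_def lie_diff_add[symmetric])
    qed
  next
    fix a x assume "a \<in> coboundaries \<gg>" "x \<in> carrier (cocycle_ring \<gg>)"
    then show "x \<otimes>\<^bsub>cocycle_ring \<gg>\<^esub> a \<in> coboundaries \<gg>" and "a \<otimes>\<^bsub>cocycle_ring \<gg>\<^esub> x \<in> coboundaries \<gg>"
      using mult by (auto simp: cocycle_ring_def coboundaries_def wedge_commute[of _ x])
  qed (rule ring_axioms)
qed

lemma cohomology_simps [simp]:
  "carrier (cohomology \<gg>) = carrier (cohomology_ring \<gg>)"
  "monoid.mult (cohomology \<gg>) = monoid.mult (cohomology_ring \<gg>)"
  "one (cohomology \<gg>) = one (cohomology_ring \<gg>)"
  "zero (cohomology \<gg>) = zero (cohomology_ring \<gg>)"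
  "add (cohomology \<gg>) = add (cohomology_ring \<gg>)"
  "smult (cohomology \<gg>) = (\<lambda>c H. \<Union>\<omega>\<in>H. cohomology_class \<gg> (scale c \<omega>))"
  by (simp_all add: cohomology_def ring.defs module.defs)

lemma carrier_cohomology_ring: "carrier (cohomology_ring \<gg>) = cohomology_class \<gg> ` cocycles \<gg>"
  by (auto simp: cohomology_ring_def cohomology_class_def FactRing_def A_RCOSETS_def RCOSETS_def
      a_r_coset_def cocycle_ring_def)

lemma cohomology_smult:
  assumes "\<gg> \<in> {m0, m2}" and "H \<in> carrier (cohomology \<gg>)"
  shows "c \<odot>\<^bsub>cohomology \<gg>\<^esub> H = (if c = 0 then \<zero>\<^bsub>cohomology \<gg>\<^esub> else H)"
proof -
  interpret ideal "coboundaries \<gg>" "cocycle_ring \<gg>"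
    by (rule coboundaries_ideal[OF assms(1)])
  obtain \<omega> where \<omega>: "\<omega> \<in> carrier (cocycle_ring \<gg>)" and H: "H = cohomology_class \<gg> \<omega>"
    using assms(2) by (auto simp: carrier_cohomology_ring cocycle_ring_def)
  have rep: "cohomology_class \<gg> \<eta> = H" if "\<eta> \<in> H" for \<eta>
    using a_repr_independence[OF _ \<omega> a_subgroup] that by (simp add: H cohomology_class_def)
  have "\<omega> \<in> H"
    using a_rcos_self[OF \<omega>] by (simp add: H cohomology_class_def)
  moreover have "cohomology_class \<gg> 0 = coboundaries \<gg>"
    using a_rcos_zero[OF ideal_axioms additive_subgroup.zero_closed[OF is_additive_subgroup]]
    by (simp add: cohomology_class_def cocycle_ring_def)
  ultimately show ?thesis
    using rep by (auto simp: scale_eq cohomology_ring_def FactRing_def)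
qed

lemma cohomology_algebra:
  assumes "\<gg> \<in> {m0, m2}"
  shows "algebra class_ring (cohomology \<gg>)"
proof -
  interpret ideal "coboundaries \<gg>" "cocycle_ring \<gg>"
    by (rule coboundaries_ideal[OF assms])
  interpret K: cring "cohomology_ring \<gg>"
    unfolding cohomology_ring_def by (rule quotient_is_cring[OF cocycle_ring_cring])
  have cring: "cring (cohomology \<gg>)"
  proof (intro cringI abelian_groupI comm_monoidI)
    fix x assume "x \<in> carrier (cohomology \<gg>)"
    then show "\<exists>y\<in>carrier (cohomology \<gg>). y \<oplus>\<^bsub>cohomology \<gg>\<^esub> x = \<zero>\<^bsub>cohomology \<gg>\<^esub>"
      using K.l_neg[of x] K.a_inv_closed[of x] by auto
  qed (simp_all add: K.a_ac K.m_ac K.l_distr K.r_distr)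
  then interpret H: cring "cohomology \<gg>" .
  have self: "H \<oplus>\<^bsub>cohomology \<gg>\<^esub> H = \<zero>\<^bsub>cohomology \<gg>\<^esub>" if carr: "H \<in> carrier (cohomology \<gg>)" for H
  proof -
    obtain \<omega> where \<omega>: "\<omega> \<in> carrier (cocycle_ring \<gg>)" and "H = cohomology_class \<gg> \<omega>"
      using carr by (auto simp: carrier_cohomology_ring cocycle_ring_def)
    then have H: "H = coboundaries \<gg> +>\<^bsub>cocycle_ring \<gg>\<^esub> \<omega>"
      by (simp add: cohomology_class_def)
    have "H \<oplus>\<^bsub>cohomology \<gg>\<^esub> H = coboundaries \<gg> +>\<^bsub>cocycle_ring \<gg>\<^esub> (\<omega> \<oplus>\<^bsub>cocycle_ring \<gg>\<^esub> \<omega>)"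
      using \<omega> by (simp add: H cohomology_ring_def FactRing_def a_rcos_sum)
    also have "\<omega> \<oplus>\<^bsub>cocycle_ring \<gg>\<^esub> \<omega> = \<zero>\<^bsub>cocycle_ring \<gg>\<^esub>"
      by (simp add: cocycle_ring_def)
    finally show ?thesis
      using a_rcos_zero[OF ideal_axioms additive_subgroup.zero_closed[OF is_additive_subgroup]]
      by (simp add: cohomology_ring_def FactRing_def)
  qed
  note sm = cohomology_smult[OF assms]
  show ?thesis
  proof (rule algebraI)
    show "cring (class_ring :: bit ring)" ..
    fix a b :: bit and x y
    assume "a \<in> carrier class_ring" "b \<in> carrier class_ring"
      and x: "x \<in> carrier (cohomology \<gg>)"
    show "(a \<oplus>\<^bsub>class_ring\<^esub> b) \<odot>\<^bsub>cohomology \<gg>\<^esub> x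
      = a \<odot>\<^bsub>cohomology \<gg>\<^esub> x \<oplus>\<^bsub>cohomology \<gg>\<^esub> b \<odot>\<^bsub>cohomology \<gg>\<^esub> x"
      using x self[OF x] by (cases a; cases b) (simp_all add: sm del: cohomology_simps)
  qed (use cring sm H.zero_closed in \<open>simp_all del: cohomology_simps\<close>)
qed

lemma cohomology_vectorspace:
  assumes "\<gg> \<in> {m0, m2}"
  shows "vectorspace class_ring (cohomology \<gg>)"
  using algebra.module[OF cohomology_algebra[OF assms]] class_field
  unfolding vectorspace_def by blast

lemma cohomology_degree_subset:
  "cohomology_degree \<gg> q \<subseteq> carrier (cohomology \<gg>)"
  by (auto simp: cohomology_degree_def carrier_cohomology_ring)

lemma positive_cohomology_vectorspace:
  assumes "\<gg> \<in> {m0, m2}"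
  shows "vectorspace class_ring (positive_cohomology \<gg>)"
proof -
  interpret vectorspace class_ring "cohomology \<gg>"
    by (rule cohomology_vectorspace[OF assms])
  show ?thesis
    unfolding positive_cohomology_def
    by (rule subspace_is_vs[OF span_is_subspace]) (use cohomology_degree_subset in blast)
qed

definition component :: "nat \<Rightarrow> form \<Rightarrow> form" where
  "component q = lin_ext (\<lambda>I. if card I = q then monomial I else 0)"

lemma component_exterior_power: "\<omega> \<in> exterior_power p \<Longrightarrow> component q \<omega> = (if p = q then \<omega> else 0)"
  by (induction \<omega> rule: exterior_power_induct) (auto simp: component_def lin_ext_add)

lemma component_closed: "\<omega> \<in> exterior_algebra \<Longrightarrow> component q \<omega> \<in> exterior_power q"
  by (induction \<omega> rule: exterior_algebra_induct) (auto simp: component_def lin_ext_add)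

lemma component_lie_diff:
  assumes "\<gg> \<in> {m0, m2}" and "\<omega> \<in> exterior_algebra"
  shows "component 0 (lie_diff \<gg> \<omega>) = 0"
    and "component (Suc q) (lie_diff \<gg> \<omega>) = lie_diff \<gg> (component q \<omega>)"
proof -
  have mon: "component q (lie_diff \<gg> (monomial I)) = (if Suc (card I) = q then lie_diff \<gg> (monomial I) else 0)"
    if "finite I" "0 \<notin> I" for I q
    using that by (intro component_exterior_power lie_diff_power[OF assms(1)]) auto
  have add: "component q (\<eta> + \<theta>) = component q \<eta> + component q \<theta>" for q \<eta> \<theta>
    by (simp add: component_def lin_ext_add)
  have zero: "component q 0 = 0" for q
    by (simp add: component_def)
  from assms(2) show "component 0 (lie_diff \<gg> \<omega>) = 0"
    by (induction \<omega> rule: exterior_algebra_induct) (simp_all add: lie_diff_add mon add zero)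
  have "component q (monomial I) = (if card I = q then monomial I else 0)" for I
    by (simp add: component_def)
  with assms(2) show "component (Suc q) (lie_diff \<gg> \<omega>) = lie_diff \<gg> (component q \<omega>)"
    by (induction \<omega> rule: exterior_algebra_induct) (simp_all add: lie_diff_add mon add zero)
qed

lemma coboundaries_power:
  assumes "\<gg> \<in> {m0, m2}"
  shows "coboundaries \<gg> \<inter> exterior_power 0 = {0}"
    and "coboundaries \<gg> \<inter> exterior_power (Suc q) = lie_diff \<gg> ` exterior_power q"
proof -
  have eq: "component p \<eta> = \<eta>" if "\<eta> \<in> exterior_power p" for p \<eta>
    using component_exterior_power[OF that, of p] by simp
  show "coboundaries \<gg> \<inter> exterior_power 0 = {0}"
  proof
    show "coboundaries \<gg> \<inter> exterior_power 0 \<subseteq> {0}"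
    proof
      fix \<eta> assume "\<eta> \<in> coboundaries \<gg> \<inter> exterior_power 0"
      then obtain \<omega> where "\<omega> \<in> exterior_algebra" "\<eta> = lie_diff \<gg> \<omega>" "component 0 \<eta> = \<eta>"
        using eq[of \<eta> 0] unfolding coboundaries_def by blast
      then show "\<eta> \<in> {0}"
        using component_lie_diff(1)[OF assms, of \<omega>] by (metis singletonI)
    qed
    show "{0} \<subseteq> coboundaries \<gg> \<inter> exterior_power 0"
      using imageI[of 0 exterior_algebra "lie_diff \<gg>"] by (simp add: coboundaries_def)
  qed
  show "coboundaries \<gg> \<inter> exterior_power (Suc q) = lie_diff \<gg> ` exterior_power q"
  proof
    show "coboundaries \<gg> \<inter> exterior_power (Suc q) \<subseteq> lie_diff \<gg> ` exterior_power q"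
    proof
      fix \<eta> assume "\<eta> \<in> coboundaries \<gg> \<inter> exterior_power (Suc q)"
      then obtain \<omega> where "\<omega> \<in> exterior_algebra" "\<eta> = lie_diff \<gg> \<omega>" "component (Suc q) \<eta> = \<eta>"
        using eq[of \<eta> "Suc q"] unfolding coboundaries_def by blast
      then show "\<eta> \<in> lie_diff \<gg> ` exterior_power q"
        using component_lie_diff(2)[OF assms, of \<omega> q] component_closed[of \<omega> q]
        by (metis imageI)
    qed
    show "lie_diff \<gg> ` exterior_power q \<subseteq> coboundaries \<gg> \<inter> exterior_power (Suc q)"
      using lie_diff_power[OF assms] exterior_power_subset unfolding coboundaries_def by blast
  qed
qed


section \<open>Finiteness of the sum defining $F$\<close>

lemma D1_nilpotent:
  assumes "\<omega> \<in> exterior_algebra"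
  shows "\<exists>n. \<forall>l\<ge>n. (D1 ^^ l) \<omega> = 0"
proof -
  have D1_zero: "(D1 ^^ l) 0 = 0" for l
    by (induction l) (simp_all add: D1_def)
  have D1_add: "(D1 ^^ l) (\<eta> + \<theta>) = (D1 ^^ l) \<eta> + (D1 ^^ l) \<theta>" for l \<eta> \<theta>
    by (induction l) (simp_all add: D1_def derivation_add)
  have D1_sum: "(D1 ^^ l) (sum g A) = (\<Sum>a\<in>A. (D1 ^^ l) (g a))" for l g and A :: "nat set"
    by (induction A rule: infinite_finite_induct) (simp_all add: D1_zero D1_add)
  have mon: "finite I \<Longrightarrow> \<Sum>I < l \<Longrightarrow> (D1 ^^ l) (monomial I) = 0" for I l
  proof (induction l arbitrary: I)
    case (Suc l)
    have "(D1 ^^ l) ((if 2 < k then dual_basis (k - 1) else 0) \<and>\<^sub>f monomial (I - {k})) = 0"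
      if "k \<in> I" for k
    proof (cases "2 < k \<and> k - 1 \<notin> I")
      case True
      have "\<Sum>I = k + \<Sum>(I - {k})"
        using Suc.prems that by (simp add: sum.remove)
      moreover have "\<Sum>(insert (k - 1) (I - {k})) = (k - 1) + \<Sum>(I - {k})"
        using Suc.prems True by (subst sum.insert) auto
      ultimately have "\<Sum>(insert (k - 1) (I - {k})) < l"
        using Suc.prems True by linarith
      with Suc True show ?thesis
        by (simp add: wedge_monomial)
    next
      case False
      then show ?thesis by (auto simp: wedge_monomial D1_zero)
    qed
    moreover have "(D1 ^^ Suc l) (monomial I) = (D1 ^^ l) (\<Sum>k\<in>I.
        (if 2 < k then dual_basis (k - 1) else 0) \<and>\<^sub>f monomial (I - {k}))"
      by (simp only: funpow_Suc_right o_apply) (simp only: D1_def derivation_monomial)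
    ultimately show ?case
      by (simp only: D1_sum) simp
  qed simp
  from assms show ?thesis
  proof (induction \<omega> rule: exterior_algebra_induct)
    case zero
    then show ?case by (simp add: D1_zero)
  next
    case (monomial I)
    then show ?case by (intro exI[of _ "Suc (\<Sum>I)"]) (simp add: mon)
  next
    case (add \<eta> \<theta>)
    then obtain m n where "\<forall>l\<ge>m. (D1 ^^ l) \<eta> = 0" "\<forall>l\<ge>n. (D1 ^^ l) \<theta> = 0" by auto
    then show ?case by (intro exI[of _ "max m n"]) (simp add: D1_add)
  qed
qed

lemma F_op_finite:
  assumes "\<omega> \<in> exterior_algebra"
  shows "finite {l. (D1 ^^ l) \<omega> \<and>\<^sub>f dual_basis (i + l + 1) \<noteq> 0}"
proof -
  obtain n where "\<forall>l\<ge>n. (D1 ^^ l) \<omega> = 0" using D1_nilpotent[OF assms] by auto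
  then have "{l. (D1 ^^ l) \<omega> \<and>\<^sub>f dual_basis (i + l + 1) \<noteq> 0} \<subseteq> {..<n}"
    by (force simp: not_less[symmetric])
  then show ?thesis using finite_subset by blast
qed

end

theory Submission
  imports Defs
begin

text \<open>Both differentials are \<open>d = e\<^sup>1 \<and> D\<^sub>1 + \<eta> \<and> D\<^sub>1\<^sup>2\<close>, with \<open>\<eta> = 0\<close> for \<open>m0\<close> and \<open>\<eta> = e\<^sup>2\<close> for \<open>m2\<close>: in
  characteristic $2$ the square of \<open>D\<^sub>1\<close> is again a derivation. So the ring \<open>ker D\<^sub>1\<close> consists of
  cocycles for both algebras. The identity \<open>D\<^sub>1 (F(\<omega>, e\<^sup>i)) = \<omega> \<and> e\<^sup>i\<close> makes \<open>D\<^sub>1\<close> surjective onto the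
  forms without constant term and without \<open>e\<^sup>1\<close>. It follows that \<open>ker D\<^sub>1\<close> meets every cohomology class
  and that the coboundaries in \<open>ker D\<^sub>1\<close> are the forms \<open>e\<^sup>1 \<and> D\<^sub>1 c\<close> with \<open>D\<^sub>1\<^sup>2 c = 0\<close>, whatever \<open>\<eta>\<close> is;
  hence the two cohomology rings are the same quotient of \<open>ker D\<^sub>1\<close>. For the basis, the coefficient at
  the leading monomial of a generator vanishes on these coboundaries and on all other generators, and
  an element of \<open>ker D\<^sub>1\<close> without constant term and without leading monomials is such a coboundary.\<close>

section \<open>Characteristic 2, coefficients, and operators obeying the Leibniz rule\<close>

lemma eq_iff_add_eq_0: "x = y \<longleftrightarrow> x + y = 0" for x y :: "'a \<Rightarrow>\<^sub>0 bit"
  by (metis add.right_neutral add_left_imp_eq add_self_eq_0)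

lemma add_self_left [simp]: "x + (x + y) = y" for x y :: "'a \<Rightarrow>\<^sub>0 bit"
  by (simp flip: add.assoc)

lemma lookup_monomial: "Poly_Mapping.lookup (monomial I) J = (if I = J then 1 else 0)"
  by (simp add: monomial_def lookup_single when_def)

lemma lookup_if_monomial:
  "Poly_Mapping.lookup (if P then monomial I else 0) J = (if P \<and> I = J then 1 else 0)"
  by (simp add: lookup_monomial)

lemma keys_exterior_algebra:
  "\<omega> \<in> exterior_algebra \<Longrightarrow> I \<in> Poly_Mapping.keys \<omega> \<Longrightarrow> finite I \<and> 0 \<notin> I"
  by (force simp: exterior_algebra_def)

text \<open>Proves operator identities: \<open>T\<close> is the sum of the two sides, a composite
  that is not literally a \<open>derivation\<close>. The induction starts at T(1) = T(1 \<and> 1) =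
  T(1) + T(1) = 0.\<close>

lemma leibniz_eq_0:
  assumes "\<omega> \<in> exterior_algebra"
    and add: "\<And>\<eta> \<theta>. T (\<eta> + \<theta>) = T \<eta> + T \<theta>"
    and leibniz: "\<And>\<eta> \<theta>. \<eta> \<in> exterior_algebra \<Longrightarrow> \<theta> \<in> exterior_algebra \<Longrightarrow>
      T (\<eta> \<and>\<^sub>f \<theta>) = T \<eta> \<and>\<^sub>f \<theta> + \<eta> \<and>\<^sub>f T \<theta>"
    and generators: "\<And>k. 1 \<le> k \<Longrightarrow> T (dual_basis k) = 0"
  shows "T \<omega> = (0 :: form)"
  using assms(1)
proof (induction \<omega> rule: exterior_algebra_induct)
  case zero
  show ?case using add[of 0 0] by simp
next
  case (monomial I)
  then show ?case
  proof (induction I rule: finite_induct)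
    case empty
    show ?case using leibniz[of "monomial {}" "monomial {}"] by simp
  next
    case (insert k I)
    then have "T (dual_basis k \<and>\<^sub>f monomial I) = 0"
      by (subst leibniz) (auto simp: generators Suc_le_eq intro!: gr0I)
    with insert show ?case by (simp add: wedge_monomial)
  qed
next
  case (add \<eta> \<theta>)
  then show ?case by (simp add: assms(2))
qed

lemma derivation_closed:
  assumes "\<omega> \<in> exterior_algebra" and "\<And>k. 1 \<le> k \<Longrightarrow> \<delta> k \<in> exterior_algebra"
  shows "derivation \<delta> \<omega> \<in> exterior_algebra"
  using assms(1)
proof (induction \<omega> rule: exterior_algebra_induct)
  case (monomial I)
  have "\<delta> k \<and>\<^sub>f monomial (I - {k}) \<in> exterior_algebra" if "k \<in> I" for k
    using monomial that assms(2)[of k] by (cases k) (auto intro!: exterior_algebra_wedge)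
  then show ?case
    by (auto simp: derivation_monomial intro: exterior_algebra_sum)
qed (auto simp: derivation_add)

lemma lookup_wedge_dual_basis:
  "Poly_Mapping.lookup (\<omega> \<and>\<^sub>f dual_basis j) L =
    (if j \<in> L then Poly_Mapping.lookup \<omega> (L - {j}) else 0)"
proof (induction \<omega> rule: form_induct)
  case (monomial I)
  show ?case
    by (auto simp: wedge_monomial lookup_monomial)
qed (simp_all add: wedge_add lookup_add)


section \<open>The derivation $D_1$ and the contraction with $e_1$\<close>

lemma D1_add: "D1 (\<omega> + \<eta>) = D1 \<omega> + D1 \<eta>"
  by (simp add: D1_def derivation_add)

lemma D1_zero [simp]: "D1 0 = 0"
  by (simp add: D1_def)

lemma D1_sum: "D1 (sum f A) = (\<Sum>a\<in>A. D1 (f a))"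
  by (induction A rule: infinite_finite_induct) (simp_all add: D1_add)

lemma D1_eq_sum: "D1 \<omega> = (\<Sum>I\<in>Poly_Mapping.keys \<omega>. D1 (monomial I))"
  using pm_eq_sum[of \<omega>] by (metis (no_types, lifting) D1_sum monomial_def sum.cong)

lemma D1_wedge:
  "\<omega> \<in> exterior_algebra \<Longrightarrow> \<eta> \<in> exterior_algebra \<Longrightarrow> D1 (\<omega> \<and>\<^sub>f \<eta>) = D1 \<omega> \<and>\<^sub>f \<eta> + \<omega> \<and>\<^sub>f D1 \<eta>"
  by (simp add: D1_def derivation_wedge)

lemma D1_dual_basis: "D1 (dual_basis k) = (if 2 < k then dual_basis (k - 1) else 0)"
  by (simp add: D1_def)

lemma D1_one [simp]: "D1 (monomial {}) = 0"
  by (simp add: D1_def derivation_monomial)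

lemma D1_power: "\<omega> \<in> exterior_power q \<Longrightarrow> D1 \<omega> \<in> exterior_power q"
  using derivation_power[of \<omega> q _ 0] by (auto simp: D1_def)

lemma D1_closed: "\<omega> \<in> exterior_algebra \<Longrightarrow> D1 \<omega> \<in> exterior_algebra"
  by (auto simp: D1_def intro!: derivation_closed)

lemma funpow_D1_power: "\<omega> \<in> exterior_power q \<Longrightarrow> (D1 ^^ l) \<omega> \<in> exterior_power q"
  by (induction l) (auto intro: D1_power)

lemma funpow_D1_closed: "\<omega> \<in> exterior_algebra \<Longrightarrow> (D1 ^^ l) \<omega> \<in> exterior_algebra"
  by (induction l) (auto intro: D1_closed)

text \<open>Only one direction: over \<open>bit\<close> the contributions of different monomials may
  cancel.\<close>

lemma keys_D1:
  assumes "K \<in> Poly_Mapping.keys (D1 \<omega>)"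
  shows "\<exists>I\<in>Poly_Mapping.keys \<omega>. \<exists>k\<in>I. 2 < k \<and> k - 1 \<notin> I \<and> K = insert (k - 1) (I - {k})"
proof (rule ccontr)
  assume contra: "\<not> ?thesis"
  have "Poly_Mapping.lookup (D1 \<omega>) K = 0"
  proof -
    have mon: "Poly_Mapping.lookup (D1 (monomial I)) K = 0" if I: "I \<in> Poly_Mapping.keys \<omega>" for I
    proof -
      have "Poly_Mapping.lookup ((if 2 < k then dual_basis (k - 1) else 0) \<and>\<^sub>f monomial (I - {k})) K = 0"
        if "k \<in> I" for k
        using contra that I by (auto simp: wedge_monomial lookup_monomial)
      then show ?thesis
        by (simp add: D1_def derivation_monomial lookup_sum)
    qed
    then show ?thesis
      unfolding D1_eq_sum[of \<omega>] by (simp add: lookup_sum)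
  qed
  with assms show False by (simp add: in_keys_iff)
qed

lemma lookup_D1_empty [simp]: "Poly_Mapping.lookup (D1 \<omega>) {} = 0"
  using keys_D1[of "{}" \<omega>] unfolding in_keys_iff by blast

text \<open>Interior product with e_1; in characteristic 2 this antiderivation is a derivation. On
  the exterior algebra its kernel consists of the forms without e^1.\<close>

definition contraction :: "form \<Rightarrow> form" where
  "contraction = derivation (\<lambda>k. if k = 1 then monomial {} else 0)"

lemma contraction_add: "contraction (\<omega> + \<eta>) = contraction \<omega> + contraction \<eta>"
  by (simp add: contraction_def derivation_add)

lemma contraction_zero [simp]: "contraction 0 = 0"
  by (simp add: contraction_def)

lemma contraction_wedge:
  "\<omega> \<in> exterior_algebra \<Longrightarrow> \<eta> \<in> exterior_algebra \<Longrightarrow>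
    contraction (\<omega> \<and>\<^sub>f \<eta>) = contraction \<omega> \<and>\<^sub>f \<eta> + \<omega> \<and>\<^sub>f contraction \<eta>"
  by (simp add: contraction_def derivation_wedge)

lemma contraction_dual_basis: "contraction (dual_basis k) = (if k = 1 then monomial {} else 0)"
  by (simp add: contraction_def)

lemma contraction_closed: "\<omega> \<in> exterior_algebra \<Longrightarrow> contraction \<omega> \<in> exterior_algebra"
  by (auto simp: contraction_def intro!: derivation_closed)

lemma contraction_one [simp]: "contraction (monomial {}) = 0"
  by (simp add: contraction_def derivation_monomial)

text \<open>In characteristic $2$ the square of a derivation and the sum \<open>\<delta>\<delta>' + \<delta>'\<delta>\<close> for two derivations
  are derivations, so identities between them need only be checked on the \<open>e\<^sup>k\<close>.\<close>

lemma contraction_contraction: "\<omega> \<in> exterior_algebra \<Longrightarrow> contraction (contraction \<omega>) = 0"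
  by (rule leibniz_eq_0[where T = "\<lambda>\<omega>. contraction (contraction \<omega>)"])
     (simp_all add: contraction_add contraction_wedge contraction_closed wedge_add
       contraction_dual_basis add_ac exterior_algebra_wedge)

text \<open>\<open>D1\<close> kills e^1 and never produces it, so both sides vanish on every
  e^k.\<close>

lemma contraction_D1: "\<omega> \<in> exterior_algebra \<Longrightarrow> contraction (D1 \<omega>) = D1 (contraction \<omega>)"
  unfolding eq_iff_add_eq_0[of "contraction (D1 \<omega>)"]
  by (rule leibniz_eq_0[where T = "\<lambda>\<omega>. contraction (D1 \<omega>) + D1 (contraction \<omega>)"])
     (auto simp: contraction_add contraction_wedge contraction_closed wedge_add D1_add
       D1_wedge D1_closed contraction_dual_basis D1_dual_basis add_ac exterior_algebra_wedge)

text \<open>The existential \<eta> treats both algebras at once. Later arguments use only that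
  \<eta> is killed by \<open>D1\<close> and by \<open>contraction\<close> and that \<eta> \<and>
  \<eta> = 0.\<close>

lemma lie_diff_D1:
  assumes "\<gg> \<in> {m0, m2}"
  shows "\<exists>\<eta>\<in>{0, dual_basis 2}. \<forall>\<omega>\<in>exterior_algebra.
    lie_diff \<gg> \<omega> = dual_basis 1 \<and>\<^sub>f D1 \<omega> + \<eta> \<and>\<^sub>f D1 (D1 \<omega>)"
proof -
  have eq: "lie_diff \<gg> \<omega> + (dual_basis 1 \<and>\<^sub>f D1 \<omega> + \<eta> \<and>\<^sub>f D1 (D1 \<omega>)) = 0"
    if \<omega>: "\<omega> \<in> exterior_algebra" and \<eta>: "\<eta> \<in> {0, dual_basis 2}"
    and e: "\<And>k. lie_diff \<gg> (dual_basis k) = dual_basis 1 \<and>\<^sub>f D1 (dual_basis k) + \<eta> \<and>\<^sub>f D1 (D1 (dual_basis k))"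
    for \<omega> \<eta>
    using \<omega>
  proof (rule leibniz_eq_0[where T = "\<lambda>\<omega>. lie_diff \<gg> \<omega> + (dual_basis 1 \<and>\<^sub>f D1 \<omega> + \<eta> \<and>\<^sub>f D1 (D1 \<omega>))"])
    fix \<omega> \<theta> assume "\<omega> \<in> exterior_algebra" "\<theta> \<in> exterior_algebra"
    then show "lie_diff \<gg> (\<omega> \<and>\<^sub>f \<theta>) + (dual_basis 1 \<and>\<^sub>f D1 (\<omega> \<and>\<^sub>f \<theta>) + \<eta> \<and>\<^sub>f D1 (D1 (\<omega> \<and>\<^sub>f \<theta>)))
      = (lie_diff \<gg> \<omega> + (dual_basis 1 \<and>\<^sub>f D1 \<omega> + \<eta> \<and>\<^sub>f D1 (D1 \<omega>))) \<and>\<^sub>f \<theta>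
      + \<omega> \<and>\<^sub>f (lie_diff \<gg> \<theta> + (dual_basis 1 \<and>\<^sub>f D1 \<theta> + \<eta> \<and>\<^sub>f D1 (D1 \<theta>)))"
      \<comment> \<open>The mixed term \<open>D1 \<omega> \<and>\<^sub>f D1 \<theta>\<close> of the
        second power of \<open>D1\<close> occurs twice and cancels.\<close>
      by (simp add: lie_diff_wedge D1_wedge D1_add D1_closed wedge_add wedge_assoc
          wedge_left_commute[of \<omega>] add_ac)
  next
    fix k
    show "lie_diff \<gg> (dual_basis k) + (dual_basis 1 \<and>\<^sub>f D1 (dual_basis k) + \<eta> \<and>\<^sub>f D1 (D1 (dual_basis k))) = 0"
      by (simp add: e)
  qed (simp add: lie_diff_add D1_add wedge_add add_ac)
  from assms consider "\<gg> = m0" | "\<gg> = m2" by blast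
  then show ?thesis
  proof cases
    case 1
    have "lie_diff \<gg> (dual_basis k) = dual_basis 1 \<and>\<^sub>f D1 (dual_basis k) + 0 \<and>\<^sub>f D1 (D1 (dual_basis k))" for k
      using 1 by (simp add: lie_diff_e_m0 D1_dual_basis)
    from eq[OF _ _ this] show ?thesis
      by (intro bexI[of _ 0] ballI) (simp_all add: eq_iff_add_eq_0[of "lie_diff \<gg> _"])
  next
    case 2
    have "lie_diff \<gg> (dual_basis k)
        = dual_basis 1 \<and>\<^sub>f D1 (dual_basis k) + dual_basis 2 \<and>\<^sub>f D1 (D1 (dual_basis k))" for k
    proof -
      have "dual_basis 2 \<and>\<^sub>f D1 (D1 (dual_basis k)) = (if 4 < k then dual_basis 2 \<and>\<^sub>f dual_basis (k - 2) else 0)"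
      \<comment> \<open>For k = 4 the second power of \<open>D1\<close> gives e^2, which the factor
        e^2 kills; hence the bound is 4 < k although the second power is nonzero from k = 4
        on.\<close>
      proof (cases "k = 4")
        case False
        then show ?thesis by (auto simp: D1_dual_basis numeral_eq_Suc)
      qed (simp add: D1_dual_basis wedge_monomial)
      then show ?thesis using 2 by (simp add: lie_diff_e_m2 D1_dual_basis)
    qed
    from eq[OF _ _ this] show ?thesis
      by (intro bexI[of _ "dual_basis 2"] ballI) (simp_all add: eq_iff_add_eq_0[of "lie_diff \<gg> _"])
  qed
qed


section \<open>The operator $F$\<close>

text \<open>The vanishing of \<open>(D1 ^^ n) \<omega>\<close> is recorded because it is the
  boundary term of the telescoping sum in \<open>D1_F_op\<close>.\<close>

lemma F_op_sum:
  assumes "\<omega> \<in> exterior_algebra"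
  shows "\<exists>n. (D1 ^^ n) \<omega> = 0 \<and> F_op \<omega> i = (\<Sum>l<n. (D1 ^^ l) \<omega> \<and>\<^sub>f dual_basis (i + l + 1))"
proof -
  obtain n where n: "\<forall>l\<ge>n. (D1 ^^ l) \<omega> = 0"
    using D1_nilpotent[OF assms] by blast
  have "F_op \<omega> i = (\<Sum>l<n. (D1 ^^ l) \<omega> \<and>\<^sub>f dual_basis (i + l + 1))"
    unfolding F_op_def
  proof (rule Sum_any.expand_superset)
    show "{l. (D1 ^^ l) \<omega> \<and>\<^sub>f dual_basis (i + l + 1) \<noteq> 0} \<subseteq> {..<n}"
      using n by (force simp: not_less[symmetric])
  qed simp
  with n show ?thesis by blast
qed

lemma F_op_power: "\<omega> \<in> exterior_power q \<Longrightarrow> F_op \<omega> i \<in> exterior_power (Suc q)"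
  unfolding F_op_def Sum_any.expand_set
  using exterior_power_wedge[OF funpow_D1_power, of \<omega> q "dual_basis _" 1]
  by (auto intro!: exterior_power_sum)

lemma F_op_closed:
  assumes "\<omega> \<in> exterior_algebra"
  shows "F_op \<omega> i \<in> exterior_algebra"
  unfolding F_op_def Sum_any.expand_set
  using assms by (auto intro!: exterior_algebra_sum exterior_algebra_wedge funpow_D1_closed)

text \<open>Telescoping: \<open>D1\<close> maps the summand l to two terms, one of which cancels
  against a term of the summand l + 1. Since 2 \<le> i, every e^(i+l+1) is really lowered.\<close>

lemma D1_F_op:
  assumes "\<omega> \<in> exterior_algebra" and "2 \<le> i"
  shows "D1 (F_op \<omega> i) = \<omega> \<and>\<^sub>f dual_basis i"
proof -
  obtain n where n: "(D1 ^^ n) \<omega> = 0"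
    and F: "F_op \<omega> i = (\<Sum>l<n. (D1 ^^ l) \<omega> \<and>\<^sub>f dual_basis (i + l + 1))"
    using F_op_sum[OF assms(1)] by blast
  have "D1 (\<Sum>l<m. (D1 ^^ l) \<omega> \<and>\<^sub>f dual_basis (i + l + 1))
      = \<omega> \<and>\<^sub>f dual_basis i + (D1 ^^ m) \<omega> \<and>\<^sub>f dual_basis (i + m)" for m
  proof (induction m)
    case (Suc m)
    have "D1 ((D1 ^^ m) \<omega> \<and>\<^sub>f dual_basis (i + m + 1))
      = (D1 ^^ Suc m) \<omega> \<and>\<^sub>f dual_basis (i + Suc m) + (D1 ^^ m) \<omega> \<and>\<^sub>f dual_basis (i + m)"
      using assms by (subst D1_wedge) (auto simp: funpow_D1_closed D1_dual_basis)
    with Suc show ?case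
      by (simp add: D1_add add_ac)
  qed simp
  from this[of n] show ?thesis by (simp add: F n)
qed

lemma lookup_contraction:
  assumes "\<omega> \<in> exterior_algebra"
  shows "Poly_Mapping.lookup (contraction \<omega>) J =
    (if 1 \<in> J then 0 else Poly_Mapping.lookup \<omega> (insert 1 J))"
  using assms
proof (induction \<omega> rule: exterior_algebra_induct)
  case (monomial I)
  have "contraction (monomial I) = (\<Sum>k\<in>I. if k = 1 then monomial (I - {1}) else 0)"
    unfolding contraction_def derivation_monomial by (intro sum.cong) auto
  with monomial have "contraction (monomial I) = (if 1 \<in> I then monomial (I - {1}) else 0)"
    by (simp add: sum.delta)
  then show ?case
    by (auto simp: lookup_monomial)
qed (simp_all add: contraction_add lookup_add)

lemma D1_surj:
  assumes b: "b \<in> exterior_algebra" "contraction b = 0" "Poly_Mapping.lookup b {} = 0"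
  shows "\<exists>c\<in>exterior_algebra. D1 c = b"
\<comment> \<open>The assumptions on \<open>b\<close> stay outside the induction: they enter through
  I \<in> \<open>keys b\<close>, which makes I nonempty and free of 0 and 1. Any index m \<ge> 2 of
  I then gives a preimage by \<open>D1_F_op\<close>.\<close>
proof (induction b rule: form_induct)
  case zero
  show ?case by (rule bexI[of _ 0]) simp_all
next
  case (monomial I)
  have I: "finite I" "0 \<notin> I" "I \<noteq> {}"
    using monomial b keys_exterior_algebra by (auto simp: in_keys_iff)
  moreover have "1 \<notin> I"
  proof
    assume "1 \<in> I"
    then have "Poly_Mapping.lookup (contraction b) (I - {1}) = Poly_Mapping.lookup b I"
      by (simp add: lookup_contraction[OF b(1)] insert_absorb)
    with monomial b(2) show False by (simp add: in_keys_iff)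
  qed
  ultimately obtain m where m: "m \<in> I" "2 \<le> m"
    by (metis One_nat_def Suc_1 Suc_leI equals0I le_neq_implies_less not_less_eq_eq zero_less_iff_neq_zero)
  have "D1 (F_op (monomial (I - {m})) m) = monomial (I - {m}) \<and>\<^sub>f dual_basis m"
    using I m by (intro D1_F_op) auto
  also have "\<dots> = monomial I"
    using m by (simp add: wedge_monomial insert_absorb)
  finally show ?case
    using I F_op_closed[of "monomial (I - {m})"] by auto
next
  case (add \<eta> \<theta>)
  then show ?case by (metis D1_add exterior_algebra_closed(2))
qed

lemma D1_surj_mod_const:
  assumes "b \<in> exterior_algebra" and "contraction b = 0"
  obtains c \<kappa> where "c \<in> exterior_algebra" "\<kappa> \<in> {0, monomial {}}" "b = \<kappa> + D1 c"
proof -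
  define \<kappa> where "\<kappa> = (if Poly_Mapping.lookup b {} = 0 then 0 else monomial {})"
  have "contraction (b + \<kappa>) = 0" "Poly_Mapping.lookup (b + \<kappa>) {} = 0" "b + \<kappa> \<in> exterior_algebra"
    using assms by (auto simp: \<kappa>_def contraction_add lookup_add lookup_monomial)
  then obtain c where "c \<in> exterior_algebra" "D1 c = b + \<kappa>"
    using D1_surj by blast
  then show ?thesis
    by (intro that[of c \<kappa>]) (auto simp: \<kappa>_def add_ac)
qed


section \<open>Leading monomials\<close>

text \<open>For indices in \<open>generator_index\<close> this is {1}, {2}, or the index set of the
  summand l = 0 of \<open>F_op\<close>: a set of numbers \<ge> 2 whose two largest elements are
  consecutive.\<close>

definition leading :: "nat + nat list \<Rightarrow> nat set" where
  "leading x = (case x of Inl k \<Rightarrow> {k} | Inr is \<Rightarrow> insert (Suc (last is)) (set is))"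

lemma sorted_le_last: "sorted_wrt (<) is \<Longrightarrow> i \<in> set is \<Longrightarrow> i \<le> last is" for i :: nat
  by (induction "is") (auto simp: less_imp_le)

text \<open>\<open>D1\<close> only lowers indices, so in the summand l of \<open>F_op\<close> the
  new factor e^(m+l+1) carries the largest index.\<close>

lemma keys_funpow_D1:
  assumes "K \<in> Poly_Mapping.keys ((D1 ^^ l) (monomial J))" and "J \<subseteq> {..m}" and "J \<noteq> {}"
  shows "K \<subseteq> {..m} \<and> K \<noteq> {}"
  using assms(1)
proof (induction l arbitrary: K)
  case 0
  with assms(2,3) show ?case by (simp add: monomial_def)
next
  case (Suc l)
  then obtain I k where "I \<in> Poly_Mapping.keys ((D1 ^^ l) (monomial J))" "k \<in> I" "K = insert (k - 1) (I - {k})"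
    using keys_D1[of K "(D1 ^^ l) (monomial J)"] by auto
  with Suc.IH[of I] show ?case by auto
qed

text \<open>In the summand l the largest index is m+l+1 and the others form a nonempty subset of
  {..m}. So no singleton occurs, and the two largest indices can be consecutive only for l = 0,
  where the summand is the monomial J times e^(m+1).\<close>

lemma lookup_F_op:
  assumes J: "finite J" "0 \<notin> J" "J \<subseteq> {..m}" "m \<in> J"
  shows "Poly_Mapping.lookup (F_op (monomial J) m) {k} = 0"
    and "p \<in> P \<Longrightarrow> P \<subseteq> {..p} \<Longrightarrow>
      Poly_Mapping.lookup (F_op (monomial J) m) (insert (Suc p) P) = (if P = J then 1 else 0)"
proof -
  obtain n where n: "(D1 ^^ n) (monomial J) = 0"
    and F: "F_op (monomial J) m = (\<Sum>l<n. (D1 ^^ l) (monomial J) \<and>\<^sub>f dual_basis (m + l + 1))"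
    using F_op_sum[OF exterior_algebra_closed(3)[OF J(1,2)]] by blast
  have lookup: "Poly_Mapping.lookup (F_op (monomial J) m) L = (\<Sum>l<n. if m + l + 1 \<in> L
      then Poly_Mapping.lookup ((D1 ^^ l) (monomial J)) (L - {m + l + 1}) else 0)" for L
    by (simp only: F lookup_sum lookup_wedge_dual_basis)
  have key: "K \<subseteq> {..m} \<and> K \<noteq> {}" if "Poly_Mapping.lookup ((D1 ^^ l) (monomial J)) K \<noteq> 0" for K l
    using keys_funpow_D1[of K l J m] that J by (auto simp: in_keys_iff)
  have "Poly_Mapping.lookup ((D1 ^^ l) (monomial J)) {} = 0" for l
    using key[of l "{}"] by blast
  then have "(if m + l + 1 \<in> {k} then Poly_Mapping.lookup ((D1 ^^ l) (monomial J)) ({k} - {m + l + 1}) else 0) = 0" for l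
    by simp
  then show "Poly_Mapping.lookup (F_op (monomial J) m) {k} = 0"
    unfolding lookup by (intro sum.neutral) blast
  assume P: "p \<in> P" "P \<subseteq> {..p}"
  define L where "L = insert (Suc p) P"
  \<comment> \<open>The summand l = 0 has to lie in the range of the finite sum.\<close>
  have "0 < n"
  proof (rule gr0I)
    assume "n = 0"
    with n have "Poly_Mapping.lookup (monomial J) J = 0" by simp
    then show False by (simp add: lookup_monomial)
  qed
  have "(if m + l + 1 \<in> L then Poly_Mapping.lookup ((D1 ^^ l) (monomial J)) (L - {m + l + 1}) else 0)
      = (if l = 0 then if P = J then 1 else 0 else 0)" for l
  proof (cases "m + l + 1 \<in> L \<and> Poly_Mapping.lookup ((D1 ^^ l) (monomial J)) (L - {m + l + 1}) \<noteq> 0")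
    case True
    then have sub: "L - {m + l + 1} \<subseteq> {..m}" and mem: "m + l + 1 \<in> L"
      using key by auto
    from mem P have "m + l \<le> p" by (auto simp: L_def)
    \<comment> \<open>\<open>Suc p\<close> lies in L, so it is the removed index m+l+1 or at most m;
      the latter contradicts m + l \<le> p. Then p itself survives in the rest, whence p \<le> m and
      l = 0.\<close>
    moreover from sub have "p = m + l \<or> p < m" by (auto simp: L_def)
    ultimately have p: "p = m + l" by linarith
    then have "p \<in> L - {m + l + 1}" using P by (simp add: L_def)
    with sub p have "l = 0" by auto
    have L: "L - {m + l + 1} = P" using p P by (auto simp: L_def)
    with True \<open>l = 0\<close> have "Poly_Mapping.lookup (monomial J) P \<noteq> 0" by simp
    then have "P = J" by (rule contrapos_np) (simp add: lookup_monomial)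
    then show ?thesis using L mem \<open>l = 0\<close> by (simp add: lookup_monomial)
  next
    case False
    have "\<not> (l = 0 \<and> P = J)"
    proof
      assume l: "l = 0 \<and> P = J"
      then have "p = m" using P J by (simp add: antisym subset_iff)
      then have "m + l + 1 \<in> L" "L - {m + l + 1} = J" using l J by (auto simp: L_def)
      with False l show False by (simp add: lookup_monomial)
    qed
    with False show ?thesis by auto
  qed
  then have "Poly_Mapping.lookup (F_op (monomial J) m) L = (\<Sum>l<n. if l = 0 then if P = J then 1 else 0 else 0)"
    unfolding lookup by (simp only:)
  with \<open>0 < n\<close> show "Poly_Mapping.lookup (F_op (monomial J) m) (insert (Suc p) P) = (if P = J then 1 else 0)"
    by (simp add: sum.delta L_def)
qed

lemma generator_index_cases:
  assumes "x \<in> generator_index"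
  obtains (Inl) k where "x = Inl k" "k \<in> {1, 2}"
  | (Inr) "is" where "x = Inr is" "sorted_wrt (<) is" "is \<noteq> []" "\<forall>i\<in>set is. 2 \<le> i"
      "set is \<subseteq> {..last is}" "last is \<in> set is" "0 \<notin> set is"
      "generator x = F_op (monomial (set is)) (last is)"
proof (cases x)
  case (Inr "is")
  moreover from this assms have "sorted_wrt (<) is" "is \<noteq> []" "\<forall>i\<in>set is. 2 \<le> i"
    by (auto simp: generator_index_def)
  ultimately show ?thesis
    by (intro that(2)[of "is"]) (auto simp: generator_def wedge_list_eq sorted_le_last)
qed (use assms that in \<open>auto simp: generator_index_def\<close>)

text \<open>The coefficients at the leading monomials are functionals dual to the generators;
  independence rests on this.\<close>

lemma lookup_generator:
  assumes x: "x \<in> generator_index" and y: "y \<in> generator_index"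
  shows "Poly_Mapping.lookup (generator x) (leading y) = (if x = y then 1 else 0)"
  using x
proof (cases rule: generator_index_cases)
  case (Inl k)
  from y show ?thesis
  proof (cases rule: generator_index_cases)
    case (Inr js)
    have "{Suc (last js), last js} \<subseteq> leading y"
      using Inr by (simp add: leading_def)
    then have "{k} \<noteq> leading y"
      by (metis insert_subset n_not_Suc_n singletonD)
    with Inl Inr show ?thesis by (simp add: generator_def lookup_monomial)
  qed (use Inl in \<open>auto simp: generator_def leading_def lookup_monomial\<close>)
next
  case ix: (Inr "is")
  note F = lookup_F_op[OF finite_set ix(7) ix(5,6)]
  from y show ?thesis
  proof (cases rule: generator_index_cases)
    case (Inl k)
    then show ?thesis using ix F(1)[of k] by (simp add: leading_def)
  next
    case (Inr js)
    then have "js = is" if "set js = set is"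
      using ix strict_sorted_equal that by metis
    then have "set js = set is \<longleftrightarrow> x = y"
      using ix Inr by auto
    then show ?thesis using ix Inr F(2)[of "last js" "set js"] by (simp add: leading_def)
  qed
qed

text \<open>By \<open>D1_F_op\<close> the result is the monomial wedged with e^(i_q), which is
  already one of its factors.\<close>

lemma D1_generator:
  assumes "x \<in> generator_index"
  shows "D1 (generator x) = 0"
  using assms
proof (cases rule: generator_index_cases)
  case (Inr "is")
  then have "D1 (generator x) = monomial (set is) \<and>\<^sub>f dual_basis (last is)"
    by (simp add: D1_F_op)
  with Inr show ?thesis by (simp add: wedge_monomial)
qed (auto simp: generator_def D1_dual_basis)

lemma generator_power:
  assumes "x \<in> generator_index"
  shows "\<exists>r\<ge>1. generator x \<in> exterior_power r"
  using assms
proof (cases rule: generator_index_cases)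
  case (Inr "is")
  then have "generator x \<in> exterior_power (Suc (card (set is)))"
    by (simp add: F_op_power)
  then show ?thesis by (intro exI[of _ "Suc (card (set is))"]) simp
qed (auto simp: generator_def intro!: exI[of _ 1])

lemma inj_leading: "inj_on leading generator_index"
  by (rule inj_onI) (metis lookup_generator zero_neq_one)

text \<open>Take a monomial \<open>I\<close> of \<open>\<omega>\<close> whose maximum \<open>k\<close> is minimal. If \<open>k - 1 \<notin> I\<close>, then \<open>D\<^sub>1\<close>
  produces the monomial \<open>I\<close> with \<open>k\<close> replaced by \<open>k - 1\<close>, and from no other monomial of \<open>\<omega>\<close>.\<close>

lemma D1_eq_0_imp_eq_0:
  assumes \<omega>: "\<omega> \<in> exterior_algebra" "D1 \<omega> = 0" "contraction \<omega> = 0" "Poly_Mapping.lookup \<omega> {} = 0"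
    and leading: "\<And>x. x \<in> generator_index \<Longrightarrow> Poly_Mapping.lookup \<omega> (leading x) = 0"
  shows "\<omega> = 0"
proof (rule ccontr)
  assume "\<omega> \<noteq> 0"
  then have "\<exists>I. I \<in> Poly_Mapping.keys \<omega>"
    by (metis equals0I keys_eq_empty)
  then obtain I where I: "I \<in> Poly_Mapping.keys \<omega>"
    and min: "\<And>I'. I' \<in> Poly_Mapping.keys \<omega> \<Longrightarrow> Max I \<le> Max I'"
    using arg_min_natI[of "\<lambda>I. I \<in> Poly_Mapping.keys \<omega>" _ Max]
      arg_min_nat_le[of "\<lambda>I. I \<in> Poly_Mapping.keys \<omega>" _ Max] by metis
  have keys: "finite K \<and> K \<noteq> {} \<and> 0 \<notin> K \<and> 1 \<notin> K" if K: "K \<in> Poly_Mapping.keys \<omega>" for K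
  proof -
    have "1 \<notin> K"
    proof
      assume "1 \<in> K"
      then have "Poly_Mapping.lookup (contraction \<omega>) (K - {1}) = Poly_Mapping.lookup \<omega> K"
        by (simp add: lookup_contraction[OF \<omega>(1)] insert_absorb)
      with K \<omega>(3) show False by (simp add: in_keys_iff)
    qed
    with K \<omega> keys_exterior_algebra show ?thesis by (auto simp: in_keys_iff)
  qed
  define k where "k = Max I"
  define J where "J = I - {k}"
  have le: "i \<le> k" if "i \<in> I" for i
    using keys[OF I] that by (auto simp: k_def)
  have ge2: "2 \<le> i" if "i \<in> I" for i
  proof -
    have "i \<noteq> 0" "i \<noteq> 1" using keys[OF I] that by auto
    then show ?thesis by linarith
  qed
  have kI: "k \<in> I" using keys[OF I] by (simp add: k_def)
  have not_leading: "I \<noteq> leading x" if "x \<in> generator_index" for x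
    using leading[OF that] I by (auto simp: in_keys_iff)
  \<comment> \<open>If k = 2, then all elements of I equal 2, and {2} is the leading monomial of
    e^2.\<close>
  have "J \<noteq> {}" if "k = 2"
  proof
    assume "J = {}"
    with kI have "I = leading (Inl 2)" by (auto simp: J_def leading_def that)
    with not_leading[of "Inl 2"] show False by (auto simp: generator_index_def)
  qed
  then have "2 < k"
    using ge2 le kI by (force simp: J_def le_less)
  \<comment> \<open>Otherwise the two largest elements of I are consecutive and I is the leading
    monomial belonging to the list J.\<close>
  have "k - 1 \<notin> I"
  proof
    assume "k - 1 \<in> I"
    then have J: "k - 1 \<in> J" "finite J" using \<open>2 < k\<close> keys[OF I] by (auto simp: J_def)
    define js where "js = sorted_list_of_set J"
    have js: "set js = J" "sorted_wrt (<) js" "js \<noteq> []"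
      using J by (auto simp: js_def)
    have "last js = k - 1"
    proof (rule antisym)
      have "last js \<in> J" using js by auto
      then have "last js \<le> k" "last js \<noteq> k" using le by (auto simp: J_def)
      then show "last js \<le> k - 1" by linarith
      show "k - 1 \<le> last js" using sorted_le_last js J by metis
    qed
    then have "leading (Inr js) = insert k J"
      using js \<open>2 < k\<close> by (simp add: leading_def)
    also have "\<dots> = I" using kI by (auto simp: J_def)
    finally have "I = leading (Inr js)" ..
    moreover have "Inr js \<in> generator_index"
      using js ge2 by (auto simp: generator_index_def J_def)
    ultimately show False using not_leading by blast
  qed
  let ?K = "insert (k - 1) J"
  have mon: "D1 (monomial K) = (\<Sum>i\<in>K. if 2 < i \<and> i - 1 \<notin> K then monomial (insert (i - 1) (K - {i})) else 0)" for K
    unfolding D1_def derivation_monomial by (intro sum.cong refl) (auto simp: wedge_monomial)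
  have "Poly_Mapping.lookup (D1 (monomial K)) ?K = (if K = I then 1 else 0)"
    if K: "K \<in> Poly_Mapping.keys \<omega>" for K
  proof -
    have "(2 < i \<and> i - 1 \<notin> K \<and> insert (i - 1) (K - {i}) = ?K) \<longleftrightarrow> K = I \<and> i = k" if i: "i \<in> K" for i
    proof
      assume "K = I \<and> i = k"
      then show "2 < i \<and> i - 1 \<notin> K \<and> insert (i - 1) (K - {i}) = ?K"
        using \<open>2 < k\<close> \<open>k - 1 \<notin> I\<close> by (simp add: J_def)
    next
      assume *: "2 < i \<and> i - 1 \<notin> K \<and> insert (i - 1) (K - {i}) = ?K"
      have bound: "j \<le> k - 1" if "j \<in> ?K" for j
        using that le by (force simp: J_def)
      have "Max K \<in> K" using keys[OF K] by auto
      \<comment> \<open>All elements of \<open>?K\<close> are at most k - 1, but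
        \<open>Max K\<close> is at least k by minimality, so the lowered index i is
        \<open>Max K\<close>; from i - 1 \<le> k - 1 follows i = k.\<close>
      then have "Max K \<le> k - 1 \<or> Max K = i" using * bound by blast
      moreover have "k \<le> Max K" using min[OF K] by (simp add: k_def)
      moreover have "i - 1 \<le> k - 1" using * bound by blast
      ultimately have "i = k" using \<open>2 < k\<close> * by linarith
      moreover from this * have "insert (k - 1) (K - {k}) = insert (k - 1) (I - {k})" "k - 1 \<notin> K"
        by (simp_all add: J_def)
      then have "K - {k} = I - {k}"
        using \<open>k - 1 \<notin> I\<close> by (metis Diff_iff insert_ident)
      then have "K = I" using i kI \<open>i = k\<close> by blast
      ultimately show "K = I \<and> i = k" by simp
    qed
    then have "Poly_Mapping.lookup (D1 (monomial K)) ?K = (\<Sum>i\<in>K. if K = I \<and> i = k then 1 else 0)"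
      unfolding mon lookup_sum lookup_if_monomial conj_assoc by (intro sum.cong refl) (simp only:)
    also have "\<dots> = (if K = I then 1 else 0)"
      using keys[OF K] kI by (cases "K = I") (simp_all add: sum.delta)
    finally show ?thesis .
  qed
  then have "Poly_Mapping.lookup (D1 \<omega>) ?K = (\<Sum>K\<in>Poly_Mapping.keys \<omega>. if K = I then 1 else 0)"
    unfolding D1_eq_sum[of \<omega>] by (simp add: lookup_sum)
  with I \<omega>(2) show False by (simp add: sum.delta)
qed

section \<open>Cocycles killed by $D_1$\<close>

lemma lookup_empty_eq_0:
  assumes "\<omega> \<in> exterior_power r" and "1 \<le> r"
  shows "Poly_Mapping.lookup \<omega> {} = 0"
proof (rule ccontr)
  assume "Poly_Mapping.lookup \<omega> {} \<noteq> 0"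
  then have "card ({} :: nat set) = r"
    using assms(1) unfolding exterior_power_def in_keys_iff[symmetric] by fast
  with assms(2) show False by simp
qed

definition D1_cocycles :: "form set" where
  "D1_cocycles = {\<omega> \<in> exterior_algebra. D1 \<omega> = 0}"

definition D1_exact :: "form set" where
  "D1_exact = {dual_basis 1 \<and>\<^sub>f D1 c | c. c \<in> exterior_algebra \<and> D1 (D1 c) = 0}"

lemma D1_cocycles_closed:
  "0 \<in> D1_cocycles"
  "monomial {} \<in> D1_cocycles"
  "\<omega> \<in> D1_cocycles \<Longrightarrow> \<eta> \<in> D1_cocycles \<Longrightarrow> \<omega> + \<eta> \<in> D1_cocycles"
  "\<omega> \<in> D1_cocycles \<Longrightarrow> \<eta> \<in> D1_cocycles \<Longrightarrow> \<omega> \<and>\<^sub>f \<eta> \<in> D1_cocycles"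
  by (auto simp: D1_cocycles_def D1_add D1_wedge exterior_algebra_wedge)

lemma D1_cocycles_sum: "(\<And>a. a \<in> A \<Longrightarrow> f a \<in> D1_cocycles) \<Longrightarrow> sum f A \<in> D1_cocycles"
  by (induction A rule: infinite_finite_induct) (auto intro: D1_cocycles_closed)

lemma generator_D1_cocycles: "x \<in> generator_index \<Longrightarrow> generator x \<in> D1_cocycles"
  using generator_power exterior_power_subset D1_generator unfolding D1_cocycles_def by blast

text \<open>\<open>D1\<close> preserves the degree, so it commutes with taking components.\<close>

lemma component_D1_cocycles:
  assumes "s \<in> D1_cocycles"
  shows "component q s \<in> D1_cocycles"
proof -
  have "D1 (component q \<omega>) = component q (D1 \<omega>)" if "\<omega> \<in> exterior_algebra" for \<omega>
    using that
  proof (induction \<omega> rule: exterior_algebra_induct)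
    case (monomial I)
    then have "D1 (monomial I) \<in> exterior_power (card I)"
      by (intro D1_power exterior_power_closed) auto
    then show ?case
      by (auto simp: component_exterior_power) (simp_all add: component_def)
  qed (simp_all add: component_def lin_ext_add D1_add)
  then show ?thesis
    using assms component_closed exterior_power_subset by (force simp: D1_cocycles_def component_def)
qed

context
  fixes \<gg> :: lie
  assumes \<gg>: "\<gg> \<in> {m0, m2}"
begin

lemma D1_cocycles_subset: "D1_cocycles \<subseteq> cocycles \<gg>"
proof -
  obtain \<eta> where "\<forall>\<omega>\<in>exterior_algebra. lie_diff \<gg> \<omega> = dual_basis 1 \<and>\<^sub>f D1 \<omega> + \<eta> \<and>\<^sub>f D1 (D1 \<omega>)"
    using lie_diff_D1[OF \<gg>] by blast
  then show ?thesis by (auto simp: D1_cocycles_def cocycles_def)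
qed

text \<open>With \<open>b\<close> the contraction of a cocycle \<open>\<omega>\<close>, contracting \<open>d\<omega> = 0\<close> shows that \<open>D\<^sub>1\<close> kills
  \<open>\<omega> + e\<^sup>1 \<and> b + \<eta> \<and> D\<^sub>1 b\<close>; writing \<open>b = \<kappa> + D\<^sub>1 c\<close>, the correction is \<open>\<kappa> e\<^sup>1 + d c\<close>.\<close>

lemma cocycles_decompose:
  assumes "\<omega> \<in> cocycles \<gg>"
  shows "\<exists>s\<in>D1_cocycles. \<omega> + s \<in> coboundaries \<gg>"
proof -
  obtain \<eta> where \<eta>: "\<eta> \<in> {0, dual_basis 2}"
    and d': "\<forall>\<omega>\<in>exterior_algebra. lie_diff \<gg> \<omega> = dual_basis 1 \<and>\<^sub>f D1 \<omega> + \<eta> \<and>\<^sub>f D1 (D1 \<omega>)"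
    using lie_diff_D1[OF \<gg>] by blast
  note d = bspec[OF d']
  have \<eta>': "\<eta> \<in> exterior_algebra" "D1 \<eta> = 0" "contraction \<eta> = 0"
    using \<eta> by (auto simp: D1_dual_basis contraction_dual_basis)
  have e1: "dual_basis 1 \<in> exterior_algebra" "D1 (dual_basis 1) = 0" "contraction (dual_basis 1) = monomial {}"
    by (auto simp: D1_dual_basis contraction_dual_basis)
  have \<omega>: "\<omega> \<in> exterior_algebra" "lie_diff \<gg> \<omega> = 0"
    using assms by (auto simp: cocycles_def)
  define b where "b = contraction \<omega>"
  have b: "b \<in> exterior_algebra" "contraction b = 0"
    using \<omega> by (simp_all add: b_def contraction_closed contraction_contraction)
  have "contraction (lie_diff \<gg> \<omega>) = D1 (\<omega> + dual_basis 1 \<and>\<^sub>f b + \<eta> \<and>\<^sub>f D1 b)"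
    using \<omega>(1) \<eta>' e1 by (simp add: d contraction_add contraction_wedge D1_closed contraction_D1
        b_def D1_add D1_wedge contraction_closed)
  then have s: "D1 (\<omega> + dual_basis 1 \<and>\<^sub>f b + \<eta> \<and>\<^sub>f D1 b) = 0"
    by (simp add: \<omega>)
  obtain c \<kappa> where c: "c \<in> exterior_algebra" "\<kappa> \<in> {0, monomial {}}" "b = \<kappa> + D1 c"
    using D1_surj_mod_const[OF b] by metis
  have \<kappa>: "\<kappa> \<in> exterior_algebra" "D1 \<kappa> = 0" using c(2) by auto
  let ?s = "\<omega> + dual_basis 1 \<and>\<^sub>f b + \<eta> \<and>\<^sub>f D1 b + dual_basis 1 \<and>\<^sub>f \<kappa>"
  have "D1 ?s = 0"
    unfolding D1_add[of _ "dual_basis 1 \<and>\<^sub>f \<kappa>"] s using e1 \<kappa> by (simp add: D1_wedge)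
  then have "?s \<in> D1_cocycles"
    using \<omega>(1) \<eta>' e1 \<kappa> b by (simp add: D1_cocycles_def exterior_algebra_wedge D1_closed)
  moreover have "\<omega> + ?s = lie_diff \<gg> c"
    using c(1) by (simp add: d c(3) D1_add \<kappa> wedge_add add_ac)
  ultimately show ?thesis
    using c(1) by (auto simp: coboundaries_def)
qed

text \<open>If the second power of \<open>D1\<close> kills c, then dc = e^1 \<and> D_1 c. Conversely
  let \<omega> = dc with c = a + e^1 \<and> b, where a and b are free of e^1. Contracting D_1
  \<omega> = 0 shows that the second power of \<open>D1\<close> on a equals \<eta> wedged with its
  third power on b. Hence the \<eta>-term of da vanishes, and a + \<eta> \<and> D_1 b is the
  required witness in place of c.\<close>

lemma D1_exact_eq: "D1_cocycles \<inter> coboundaries \<gg> = D1_exact"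
proof -
  obtain \<eta> where \<eta>: "\<eta> \<in> {0, dual_basis 2}"
    and d': "\<forall>\<omega>\<in>exterior_algebra. lie_diff \<gg> \<omega> = dual_basis 1 \<and>\<^sub>f D1 \<omega> + \<eta> \<and>\<^sub>f D1 (D1 \<omega>)"
    using lie_diff_D1[OF \<gg>] by blast
  note d = bspec[OF d']
  have \<eta>': "\<eta> \<in> exterior_algebra" "D1 \<eta> = 0" "contraction \<eta> = 0"
    and \<eta>\<eta>: "\<eta> \<and>\<^sub>f (\<eta> \<and>\<^sub>f \<theta>) = 0" for \<theta>
    using \<eta> by (auto simp: D1_dual_basis contraction_dual_basis wedge_assoc[symmetric]
        wedge_monomial[of "{2}" "{2}"])
  have e1: "dual_basis 1 \<in> exterior_algebra" "D1 (dual_basis 1) = 0" "contraction (dual_basis 1) = monomial {}"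
    and e1e1: "dual_basis 1 \<and>\<^sub>f (dual_basis 1 \<and>\<^sub>f \<theta>) = 0" for \<theta>
    by (auto simp: D1_dual_basis contraction_dual_basis wedge_assoc[symmetric]
        wedge_monomial[of "{Suc 0}" "{Suc 0}"])
  show ?thesis
  proof (intro equalityI subsetI)
    fix \<omega> assume "\<omega> \<in> D1_exact"
    then obtain c where c: "c \<in> exterior_algebra" "D1 (D1 c) = 0" "\<omega> = dual_basis 1 \<and>\<^sub>f D1 c"
      by (auto simp: D1_exact_def)
    then have "lie_diff \<gg> c = \<omega>" by (simp add: d)
    moreover have "\<omega> \<in> D1_cocycles"
      using c e1 by (simp add: D1_cocycles_def exterior_algebra_wedge D1_closed D1_wedge)
    ultimately show "\<omega> \<in> D1_cocycles \<inter> coboundaries \<gg>"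
      using c(1) by (auto simp: coboundaries_def)
  next
    fix \<omega> assume "\<omega> \<in> D1_cocycles \<inter> coboundaries \<gg>"
    then obtain c where \<omega>: "D1 \<omega> = 0" "\<omega> = lie_diff \<gg> c" and c: "c \<in> exterior_algebra"
      by (auto simp: D1_cocycles_def coboundaries_def)
    define b where "b = contraction c"
    define a where "a = c + dual_basis 1 \<and>\<^sub>f b"
    have b: "b \<in> exterior_algebra" "contraction b = 0"
      using c by (simp_all add: b_def contraction_closed contraction_contraction)
    have a: "a \<in> exterior_algebra" "contraction a = 0"
      using c b e1 by (auto simp: a_def contraction_add contraction_wedge exterior_algebra_wedge)
        (simp add: b_def)
    have "c = a + dual_basis 1 \<and>\<^sub>f b"
      by (simp add: a_def add_ac)
    then have \<omega>_eq: "\<omega> = dual_basis 1 \<and>\<^sub>f (D1 a + \<eta> \<and>\<^sub>f D1 (D1 b)) + \<eta> \<and>\<^sub>f D1 (D1 a)"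
      using a b e1 by (simp add: \<omega>(2) d D1_add D1_wedge D1_closed wedge_add
          e1e1 wedge_left_commute[of \<eta> "dual_basis _"] add_ac exterior_algebra_wedge
          del: One_nat_def)
    have "contraction (D1 \<omega>) = D1 (D1 a) + \<eta> \<and>\<^sub>f D1 (D1 (D1 b))"
      using a b e1 \<eta>' by (simp add: \<omega>_eq D1_add D1_wedge D1_closed exterior_algebra_wedge
          contraction_add contraction_wedge contraction_D1)
    then have eq0: "D1 (D1 a) + \<eta> \<and>\<^sub>f D1 (D1 (D1 b)) = 0"
      by (simp add: \<omega>(1))
    then have "D1 (D1 a) = \<eta> \<and>\<^sub>f D1 (D1 (D1 b))"
      using eq_iff_add_eq_0 by blast
    then have "\<omega> = dual_basis 1 \<and>\<^sub>f D1 (a + \<eta> \<and>\<^sub>f D1 b)"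
      using \<eta>' b by (simp add: \<omega>_eq \<eta>\<eta> D1_add D1_wedge D1_closed)
    moreover have "D1 (D1 (a + \<eta> \<and>\<^sub>f D1 b)) = 0"
      using \<eta>' b eq0 by (simp add: D1_add D1_wedge D1_closed)
    moreover have "a + \<eta> \<and>\<^sub>f D1 b \<in> exterior_algebra"
      using \<eta>' a b by (simp add: exterior_algebra_wedge D1_closed)
    ultimately show "\<omega> \<in> D1_exact"
      by (auto simp: D1_exact_def)
  qed
qed

end

section \<open>Expansion of cocycles in generators by their leading coefficients\<close>

lemma lookup_leading_D1_exact:
  assumes "x \<in> generator_index" and "\<omega> \<in> D1_exact"
  shows "Poly_Mapping.lookup \<omega> (leading x) = 0"
proof -
  obtain c where \<omega>: "\<omega> = D1 c \<and>\<^sub>f dual_basis 1"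
    using assms(2) by (auto simp: D1_exact_def wedge_commute[of _ "dual_basis _"])
  from assms(1) show ?thesis
  proof (cases rule: generator_index_cases)
    case (Inl k)
    then show ?thesis
      by (auto simp: \<omega> leading_def lookup_wedge_dual_basis simp del: One_nat_def)
  next
    case (Inr "is")
    then have "2 \<le> i" if "i \<in> leading x" for i
      using that by (auto simp: leading_def intro: le_SucI)
    then have "1 \<notin> leading x" by fastforce
    then show ?thesis by (simp add: \<omega> lookup_wedge_dual_basis)
  qed
qed

text \<open>Split s = a + e^1 \<and> b with b the contraction of s. The coefficient of s at {1} is
  the constant term of b, so b = D_1 c by \<open>D1_surj\<close> and e^1 \<and> b is exact. The
  remaining a satisfies \<open>D1_eq_0_imp_eq_0\<close>.\<close>

lemma D1_cocycle_leading_eq_0: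
  assumes s: "s \<in> D1_cocycles" "Poly_Mapping.lookup s {} = 0"
    and leading: "\<And>x. x \<in> generator_index \<Longrightarrow> Poly_Mapping.lookup s (leading x) = 0"
  shows "s \<in> D1_exact"
proof -
  have e1: "dual_basis 1 \<in> exterior_algebra" "D1 (dual_basis 1) = 0" "contraction (dual_basis 1) = monomial {}"
    by (auto simp: D1_dual_basis contraction_dual_basis)
  have s': "s \<in> exterior_algebra" "D1 s = 0"
    using s by (auto simp: D1_cocycles_def)
  define b where "b = contraction s"
  define a where "a = s + dual_basis 1 \<and>\<^sub>f b"
  have b: "b \<in> exterior_algebra" "contraction b = 0" "D1 b = 0"
    using s' contraction_D1[OF s'(1)] by (simp_all add: b_def contraction_closed contraction_contraction)
  have "Inl 1 \<in> generator_index" by (auto simp: generator_index_def)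
  then have "Poly_Mapping.lookup b {} = 0"
    using leading[of "Inl 1"] s' by (simp add: b_def lookup_contraction leading_def)
  then obtain c where c: "c \<in> exterior_algebra" "D1 c = b"
    using D1_surj b by blast
  with b have exact: "dual_basis 1 \<and>\<^sub>f b \<in> D1_exact"
    by (auto simp: D1_exact_def)
  have lookup: "Poly_Mapping.lookup (dual_basis 1 \<and>\<^sub>f b) {} = 0"
    unfolding wedge_commute[of _ b] lookup_wedge_dual_basis by simp
  have "a = 0"
  proof (rule D1_eq_0_imp_eq_0)
    show "a \<in> exterior_algebra"
      using s' b e1 by (simp add: a_def exterior_algebra_wedge)
    show "D1 a = 0"
      unfolding a_def D1_add D1_wedge[OF e1(1) b(1)] by (simp only: s' b e1) simp
    show "contraction a = 0"
      unfolding a_def contraction_add contraction_wedge[OF e1(1) b(1)] by (simp only: b e1) (simp flip: b_def)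
    show "Poly_Mapping.lookup a {} = 0"
      unfolding a_def lookup_add s lookup by simp
    show "Poly_Mapping.lookup a (leading x) = 0" if "x \<in> generator_index" for x
      unfolding a_def lookup_add leading[OF that] lookup_leading_D1_exact[OF that exact] by simp
  qed
  then have "s = dual_basis 1 \<and>\<^sub>f b"
    unfolding a_def using eq_iff_add_eq_0 by blast
  with exact show ?thesis by simp
qed

text \<open>Every nonzero coefficient is 1, so it suffices to add the generators whose leading
  coefficient in s is nonzero. They are finitely many because \<open>leading\<close> maps them
  injectively into \<open>keys s\<close>.\<close>

lemma D1_cocycle_expand:
  assumes s: "s \<in> D1_cocycles" "Poly_Mapping.lookup s {} = 0"
  obtains X where "finite X" "X \<subseteq> generator_index" "s + sum generator X \<in> D1_exact"
proof -
  define X where "X = {x \<in> generator_index. Poly_Mapping.lookup s (leading x) \<noteq> 0}"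
  have "leading ` X \<subseteq> Poly_Mapping.keys s"
    by (auto simp: X_def in_keys_iff)
  moreover have "inj_on leading X"
    using inj_leading by (rule inj_on_subset) (auto simp: X_def)
  ultimately have fin: "finite X"
    by (metis finite_imageD finite_keys finite_subset)
  have sub: "X \<subseteq> generator_index" by (auto simp: X_def)
  have "s + sum generator X \<in> D1_exact"
  proof (rule D1_cocycle_leading_eq_0)
    show "s + sum generator X \<in> D1_cocycles"
      using s sub by (intro D1_cocycles_closed D1_cocycles_sum generator_D1_cocycles) auto
    have "Poly_Mapping.lookup (generator x) {} = 0" if x: "x \<in> X" for x
    proof -
      obtain r where "1 \<le> r" "generator x \<in> exterior_power r"
        using generator_power x sub by blast
      then show ?thesis by (rule lookup_empty_eq_0[rotated])
    qed
    with s(2) show "Poly_Mapping.lookup (s + sum generator X) {} = 0"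
      by (simp add: lookup_add lookup_sum)
    fix y assume y: "y \<in> generator_index"
    have "(\<Sum>x\<in>X. Poly_Mapping.lookup (generator x) (leading y)) = (\<Sum>x\<in>X. if x = y then 1 else 0)"
      using sub y by (intro sum.cong refl lookup_generator) auto
    then show "Poly_Mapping.lookup (s + sum generator X) (leading y) = 0"
      using fin y by (auto simp: lookup_add lookup_sum sum.delta X_def)
  qed
  with fin sub that show ?thesis by blast
qed


section \<open>The cohomology classes\<close>

lemma cohomology_class_eq: "cohomology_class \<gg> \<omega> = (\<lambda>\<beta>. \<beta> + \<omega>) ` coboundaries \<gg>"
  by (auto simp: cohomology_class_def a_r_coset_def' cocycle_ring_def)

lemma coboundaries_closed:
  "0 \<in> coboundaries \<gg>"
  "\<omega> \<in> coboundaries \<gg> \<Longrightarrow> \<eta> \<in> coboundaries \<gg> \<Longrightarrow> \<omega> + \<eta> \<in> coboundaries \<gg>"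
  using imageI[of 0 exterior_algebra "lie_diff \<gg>"]
  by (auto simp: coboundaries_def simp flip: lie_diff_add)

lemma cohomology_class_eq_iff:
  "cohomology_class \<gg> \<omega> = cohomology_class \<gg> \<eta> \<longleftrightarrow> \<omega> + \<eta> \<in> coboundaries \<gg>"
proof
  assume "cohomology_class \<gg> \<omega> = cohomology_class \<gg> \<eta>"
  then have "\<omega> \<in> cohomology_class \<gg> \<eta>"
    using coboundaries_closed(1) by (force simp: cohomology_class_eq)
  then obtain \<beta> where "\<beta> \<in> coboundaries \<gg>" "\<omega> = \<beta> + \<eta>"
    by (auto simp: cohomology_class_eq)
  then show "\<omega> + \<eta> \<in> coboundaries \<gg>"
    by (simp add: add.assoc)
next
  have sub: "cohomology_class \<gg> \<omega> \<subseteq> cohomology_class \<gg> \<eta>" if "\<omega> + \<eta> \<in> coboundaries \<gg>" for \<omega> \<eta>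
  proof -
    have "\<beta> + \<omega> \<in> cohomology_class \<gg> \<eta>" if "\<beta> \<in> coboundaries \<gg>" for \<beta>
      unfolding cohomology_class_eq
    proof (rule image_eqI)
      show "\<beta> + \<omega> = (\<beta> + (\<omega> + \<eta>)) + \<eta>" by (simp add: add.assoc)
      show "\<beta> + (\<omega> + \<eta>) \<in> coboundaries \<gg>"
        using \<open>\<omega> + \<eta> \<in> coboundaries \<gg>\<close> that by (rule coboundaries_closed(2)[rotated])
    qed
    then show ?thesis by (auto simp: cohomology_class_eq[of _ \<omega>])
  qed
  assume "\<omega> + \<eta> \<in> coboundaries \<gg>"
  then show "cohomology_class \<gg> \<omega> = cohomology_class \<gg> \<eta>"
    using sub[of \<omega> \<eta>] sub[of \<eta> \<omega>] by (simp add: add.commute subset_antisym)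
qed

context
  fixes \<gg> :: lie
  assumes \<gg>: "\<gg> \<in> {m0, m2}"
begin

interpretation coboundaries: ideal "coboundaries \<gg>" "cocycle_ring \<gg>"
  by (rule coboundaries_ideal[OF \<gg>])

lemma cohomology_class_add:
  "\<omega> \<in> cocycles \<gg> \<Longrightarrow> \<eta> \<in> cocycles \<gg> \<Longrightarrow>
    cohomology_class \<gg> \<omega> \<oplus>\<^bsub>cohomology \<gg>\<^esub> cohomology_class \<gg> \<eta> = cohomology_class \<gg> (\<omega> + \<eta>)"
  using coboundaries.a_rcos_sum[of \<omega> \<eta>]
  by (simp add: cohomology_class_def cohomology_ring_def FactRing_def) (simp add: cocycle_ring_def)

lemma cohomology_class_mult:
  "\<omega> \<in> cocycles \<gg> \<Longrightarrow> \<eta> \<in> cocycles \<gg> \<Longrightarrow>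
    cohomology_class \<gg> \<omega> \<otimes>\<^bsub>cohomology \<gg>\<^esub> cohomology_class \<gg> \<eta> = cohomology_class \<gg> (\<omega> \<and>\<^sub>f \<eta>)"
  using coboundaries.rcoset_mult_add[of \<omega> \<eta>]
  by (simp add: cohomology_class_def cohomology_ring_def FactRing_def) (simp add: cocycle_ring_def)

lemma cohomology_one: "\<one>\<^bsub>cohomology \<gg>\<^esub> = cohomology_class \<gg> (monomial {})"
  by (simp add: cohomology_class_def cohomology_ring_def FactRing_def cocycle_ring_def)

lemma cohomology_zero: "\<zero>\<^bsub>cohomology \<gg>\<^esub> = cohomology_class \<gg> 0"
  by (simp add: cohomology_class_eq cohomology_ring_def FactRing_def)

lemma carrier_cohomology: "carrier (cohomology \<gg>) = cohomology_class \<gg> ` D1_cocycles"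
proof -
  have "cohomology_class \<gg> \<omega> \<in> cohomology_class \<gg> ` D1_cocycles" if "\<omega> \<in> cocycles \<gg>" for \<omega>
    using cocycles_decompose[OF \<gg> that] by (metis cohomology_class_eq_iff imageI)
  then show ?thesis
    using D1_cocycles_subset[OF \<gg>] by (auto simp: carrier_cohomology_ring)
qed

text \<open>If \<omega> + s = dc, the degree-q component \<omega> + \<open>component q s\<close> is
  again a coboundary because d is homogeneous; for q = 0 it is zero.\<close>

lemma cohomology_degree_eq:
  "cohomology_degree \<gg> q = cohomology_class \<gg> ` (D1_cocycles \<inter> exterior_power q)"
proof -
  have "cohomology_class \<gg> \<omega> \<in> cohomology_class \<gg> ` (D1_cocycles \<inter> exterior_power q)"
    if \<omega>: "\<omega> \<in> cocycles \<gg>" "\<omega> \<in> exterior_power q" for \<omega>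
  proof -
    obtain s c where s: "s \<in> D1_cocycles" and c: "c \<in> exterior_algebra" "\<omega> + s = lie_diff \<gg> c"
      using cocycles_decompose[OF \<gg> \<omega>(1)] by (auto simp: coboundaries_def)
    have "component q (lie_diff \<gg> c) \<in> coboundaries \<gg>"
    proof (cases q)
      case 0
      then show ?thesis
        using component_lie_diff(1)[OF \<gg> c(1)] coboundaries_closed(1) by simp
    next
      case (Suc p)
      then show ?thesis
        using component_lie_diff(2)[OF \<gg> c(1)] component_closed[OF c(1)] exterior_power_subset
        unfolding coboundaries_def by blast
    qed
    moreover have "component q (\<omega> + s) = component q \<omega> + component q s"
      by (simp add: component_def lin_ext_add)
    ultimately have "\<omega> + component q s \<in> coboundaries \<gg>"
      using component_exterior_power[OF \<omega>(2)] c(2) by simp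
    moreover have "component q s \<in> D1_cocycles \<inter> exterior_power q"
      using s component_D1_cocycles component_closed by (simp add: D1_cocycles_def)
    ultimately show ?thesis
      using cohomology_class_eq_iff by blast
  qed
  then show ?thesis
    using D1_cocycles_subset[OF \<gg>] by (auto simp: cohomology_degree_def)
qed

text \<open>The criterion does not mention the Lie algebra, which is what identifies the two
  cohomology rings.\<close>

lemma cohomology_class_D1_eq_iff:
  assumes "s \<in> D1_cocycles" and "t \<in> D1_cocycles"
  shows "cohomology_class \<gg> s = cohomology_class \<gg> t \<longleftrightarrow> s + t \<in> D1_exact"
  unfolding cohomology_class_eq_iff D1_exact_eq[OF \<gg>, symmetric]
  using D1_cocycles_closed(3)[OF assms] by blast

lemma cohomology_class_generator_inj:
  "inj_on (\<lambda>x. cohomology_class \<gg> (generator x)) generator_index"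
proof (rule inj_onI)
  fix x y assume xy: "x \<in> generator_index" "y \<in> generator_index"
    and "cohomology_class \<gg> (generator x) = cohomology_class \<gg> (generator y)"
  then have "generator x + generator y \<in> D1_exact"
    by (simp add: cohomology_class_D1_eq_iff generator_D1_cocycles)
  from lookup_leading_D1_exact[OF xy(1) this] show "x = y"
    using xy by (simp add: lookup_add lookup_generator split: if_splits)
qed

lemma finsum_cohomology_class:
  assumes "finite X" and "\<And>x. x \<in> X \<Longrightarrow> f x \<in> cocycles \<gg>"
  shows "finsum (cohomology \<gg>) (\<lambda>x. cohomology_class \<gg> (f x)) X = cohomology_class \<gg> (sum f X)"
proof -
  interpret H: vectorspace class_ring "cohomology \<gg>"
    by (rule cohomology_vectorspace[OF \<gg>])
  have cocycles_sum: "sum f X \<in> cocycles \<gg>" if "\<And>x. x \<in> X \<Longrightarrow> f x \<in> cocycles \<gg>" for X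
    using that by (induction X rule: infinite_finite_induct) (auto simp: cocycles_def lie_diff_add)
  have carr: "cohomology_class \<gg> \<omega> \<in> carrier (cohomology \<gg>)" if "\<omega> \<in> cocycles \<gg>" for \<omega>
    using that by (simp add: carrier_cohomology_ring)
  show ?thesis
    using assms
  proof (induction X rule: finite_induct)
    case empty
    show ?case unfolding H.M.finsum_empty cohomology_zero by simp
  next
    case (insert x X)
    have "finsum (cohomology \<gg>) (\<lambda>x. cohomology_class \<gg> (f x)) (insert x X)
      = cohomology_class \<gg> (f x) \<oplus>\<^bsub>cohomology \<gg>\<^esub> finsum (cohomology \<gg>) (\<lambda>x. cohomology_class \<gg> (f x)) X"
      using insert carr by (intro H.M.finsum_insert) auto
    also have "\<dots> = cohomology_class \<gg> (f x) \<oplus>\<^bsub>cohomology \<gg>\<^esub> cohomology_class \<gg> (sum f X)"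
      using insert by simp
    also have "\<dots> = cohomology_class \<gg> (f x + sum f X)"
      using insert by (intro cohomology_class_add cocycles_sum) auto
    finally show ?case using insert by simp
  qed
qed

lemma cohomology_smult_class:
  assumes "\<omega> \<in> cocycles \<gg>"
  shows "c \<odot>\<^bsub>cohomology \<gg>\<^esub> cohomology_class \<gg> \<omega> = cohomology_class \<gg> (scale c \<omega>)"
  using assms by (subst cohomology_smult[OF \<gg>]) (auto simp: carrier_cohomology_ring cohomology_zero scale_eq
      simp del: cohomology_simps(4))

text \<open>\<open>lincomb\<close> sums over a set of classes; injectivity of the classes allows
  reindexing by the generator indices.\<close>

lemma lincomb_generator:
  assumes "finite X" and "X \<subseteq> generator_index"
  shows "LinearCombinations.module.lincomb (cohomology \<gg>) a ((\<lambda>x. cohomology_class \<gg> (generator x)) ` X)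
    = cohomology_class \<gg> (\<Sum>x\<in>X. scale (a (cohomology_class \<gg> (generator x))) (generator x))"
proof -
  interpret H: vectorspace class_ring "cohomology \<gg>"
    by (rule cohomology_vectorspace[OF \<gg>])
  have cocycle: "generator x \<in> cocycles \<gg>" if "x \<in> X" for x
    using that assms(2) generator_D1_cocycles D1_cocycles_subset[OF \<gg>] by blast
  have scale_cocycle: "scale c (generator x) \<in> cocycles \<gg>" if "x \<in> X" for x c
    using cocycle[OF that] by (auto simp: scale_eq cocycles_def)
  have carr: "cohomology_class \<gg> \<omega> \<in> carrier (cohomology \<gg>)" if "\<omega> \<in> cocycles \<gg>" for \<omega>
    using that by (simp add: carrier_cohomology_ring)
  have "H.lincomb a ((\<lambda>x. cohomology_class \<gg> (generator x)) ` X)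
    = finsum (cohomology \<gg>) (\<lambda>x. a (cohomology_class \<gg> (generator x)) \<odot>\<^bsub>cohomology \<gg>\<^esub> cohomology_class \<gg> (generator x)) X"
    unfolding H.lincomb_def
    using carr[OF cocycle] carr[OF scale_cocycle] cohomology_class_generator_inj assms(2)
    by (intro H.M.finsum_reindex) (auto simp: cohomology_smult_class[OF cocycle] intro: inj_on_subset
        simp del: cohomology_simps)
  also have "\<dots> = finsum (cohomology \<gg>) (\<lambda>x. cohomology_class \<gg> (scale (a (cohomology_class \<gg> (generator x))) (generator x))) X"
    using carr[OF scale_cocycle] by (intro H.M.finsum_cong' refl) (auto simp: cohomology_smult_class[OF cocycle]
        simp del: cohomology_simps)
  also have "\<dots> = cohomology_class \<gg> (\<Sum>x\<in>X. scale (a (cohomology_class \<gg> (generator x))) (generator x))"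
    using assms(1) scale_cocycle by (intro finsum_cohomology_class)
  finally show ?thesis .
qed

text \<open>Spanning is \<open>D1_cocycle_expand\<close>; independence follows by reading off
  leading coefficients, which vanish on \<open>D1_exact\<close>.\<close>

lemma basis_positive_cohomology:
  "vectorspace.basis class_ring (positive_cohomology \<gg>)
    ((\<lambda>x. cohomology_class \<gg> (generator x)) ` generator_index)"
proof -
  interpret H: vectorspace class_ring "cohomology \<gg>"
    by (rule cohomology_vectorspace[OF \<gg>])
  interpret P: vectorspace class_ring "positive_cohomology \<gg>"
    by (rule positive_cohomology_vectorspace[OF \<gg>])
  let ?cls = "\<lambda>x. cohomology_class \<gg> (generator x)"
  let ?G = "?cls ` generator_index"
  let ?U = "\<Union>r\<in>{1..}. cohomology_degree \<gg> r"
  have U: "?U \<subseteq> carrier (cohomology \<gg>)"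
    using cohomology_degree_subset by blast
  have "?G \<subseteq> ?U"
  proof
    fix v assume "v \<in> ?G"
    then obtain x where x: "x \<in> generator_index" "v = ?cls x" by blast
    moreover obtain r where "1 \<le> r" "generator x \<in> exterior_power r"
      using generator_power x by blast
    ultimately show "v \<in> ?U"
      using generator_D1_cocycles by (auto simp: cohomology_degree_eq)
  qed
  then have G: "?G \<subseteq> H.span ?U" "?G \<subseteq> carrier (cohomology \<gg>)"
    using H.in_own_span[OF U] U by blast+
  have sub: "submodule class_ring (H.span ?U) (cohomology \<gg>)"
    by (rule H.span_is_submodule[OF U])
  \<comment> \<open>Span and linear dependence of the classes are the same in the subspace as in the
    whole cohomology, so all further work is done in the latter.\<close>
  note P = H.span_li_not_depend[OF G(1) sub, folded positive_cohomology_def]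
  have "?U \<subseteq> H.span ?G"
  proof
    fix v assume "v \<in> ?U"
    then obtain r s where r: "1 \<le> r" and s: "s \<in> D1_cocycles" "s \<in> exterior_power r"
      and v: "v = cohomology_class \<gg> s"
      by (auto simp: cohomology_degree_eq)
    from r s(2) have "Poly_Mapping.lookup s {} = 0"
      by (intro lookup_empty_eq_0)
    then obtain X where X: "finite X" "X \<subseteq> generator_index" "s + sum generator X \<in> D1_exact"
      using D1_cocycle_expand[OF s(1)] by metis
    have "sum generator X \<in> D1_cocycles"
      using X(2) by (intro D1_cocycles_sum generator_D1_cocycles) auto
    then have "v = cohomology_class \<gg> (sum generator X)"
      using X(3) s(1) by (simp add: v cohomology_class_D1_eq_iff)
    also have "\<dots> = H.lincomb (\<lambda>_. 1) (?cls ` X)"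
      using X by (simp add: lincomb_generator scale_eq)
    finally show "v \<in> H.span ?G"
      using X unfolding H.span_def by (intro CollectI exI[of _ "\<lambda>_. 1"] exI[of _ "?cls ` X"]) auto
  qed
  then have "H.span ?U \<subseteq> H.span ?G"
    by (rule H.span_is_subset[OF _ H.span_is_submodule[OF G(2)]])
  moreover have "H.span ?G \<subseteq> H.span ?U"
    by (rule H.span_is_subset[OF G(1) sub])
  ultimately have "H.span ?G = carrier (positive_cohomology \<gg>)"
    by (simp add: positive_cohomology_def)
  moreover have "\<not> H.lin_dep ?G"
  proof
    assume "H.lin_dep ?G"
    then obtain A a v where A: "finite A" "A \<subseteq> ?G" "H.lincomb a A = \<zero>\<^bsub>cohomology \<gg>\<^esub>" "v \<in> A" "a v \<noteq> 0"
      unfolding H.lin_dep_def by auto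
    then obtain X where X: "X \<subseteq> generator_index" "A = ?cls ` X"
      using subset_imageE by metis
    have fin: "finite X"
      using A(1) X inj_on_subset[OF cohomology_class_generator_inj X(1)] by (simp add: finite_image_iff)
    let ?s = "\<Sum>x\<in>X. scale (a (?cls x)) (generator x)"
    have "?s \<in> D1_cocycles"
      using X(1) by (intro D1_cocycles_sum) (auto simp: scale_eq D1_cocycles_closed generator_D1_cocycles)
    moreover have "cohomology_class \<gg> ?s = cohomology_class \<gg> 0"
      using A(3) fin X by (simp only: lincomb_generator cohomology_zero)
    ultimately have exact: "?s \<in> D1_exact"
      using cohomology_class_D1_eq_iff[OF _ D1_cocycles_closed(1)] by simp
    obtain y where y: "y \<in> X" "v = ?cls y"
      using A(4) X by blast
    \<comment> \<open>The leading monomial of y isolates the coefficient of v, which exactness of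
      the sum forces to be 0.\<close>
    have "Poly_Mapping.lookup ?s (leading y) = (\<Sum>x\<in>X. if x = y then a (?cls y) else 0)"
      unfolding lookup_sum
    proof (intro sum.cong refl)
      fix x assume "x \<in> X"
      then have "Poly_Mapping.lookup (generator x) (leading y) = (if x = y then 1 else 0)"
        using X(1) y by (intro lookup_generator) auto
      then show "Poly_Mapping.lookup (scale (a (?cls x)) (generator x)) (leading y)
          = (if x = y then a (?cls y) else 0)"
        by (cases "x = y") (simp_all add: scale_eq)
    qed
    also have "\<dots> = a v" using fin y by (simp add: sum.delta)
    finally show False
      using lookup_leading_D1_exact[OF _ exact, of y] A(5) X(1) y by auto
  qed
  ultimately show ?thesis
    using P \<open>?G \<subseteq> H.span ?U\<close> unfolding P.basis_def by (simp add: positive_cohomology_def)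
qed

end

section \<open>The graded ring isomorphism\<close>

lemma ring_iso_cohomology:
  "\<exists>\<phi>\<in>ring_iso (cohomology m0) (cohomology m2). \<forall>q. \<phi> ` cohomology_degree m0 q = cohomology_degree m2 q"
proof -
  \<comment> \<open>A class of \<open>m0\<close> is sent to the class in \<open>m2\<close> of a
    representative killed by \<open>D1\<close>; by \<open>eq_iff\<close> below the choice does not
    matter.\<close>
  define \<phi> where "\<phi> H = cohomology_class m2 (SOME s. s \<in> D1_cocycles \<and> cohomology_class m0 s = H)" for H
  have mem: "m0 \<in> {m0, m2}" "m2 \<in> {m0, m2}" by auto
  have eq_iff: "cohomology_class m0 s = cohomology_class m0 t \<longleftrightarrow> cohomology_class m2 s = cohomology_class m2 t"
    if "s \<in> D1_cocycles" "t \<in> D1_cocycles" for s t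
    using that by (simp add: cohomology_class_D1_eq_iff[OF mem(1)] cohomology_class_D1_eq_iff[OF mem(2)])
  have \<phi>: "\<phi> (cohomology_class m0 s) = cohomology_class m2 s" if s: "s \<in> D1_cocycles" for s
  proof -
    let ?P = "\<lambda>t. t \<in> D1_cocycles \<and> cohomology_class m0 t = cohomology_class m0 s"
    have "?P (SOME t. ?P t)" using s by (intro someI[of ?P s]) simp
    with eq_iff s show ?thesis unfolding \<phi>_def by blast
  qed
  have "\<phi> \<in> Ring.ring_hom (cohomology m0) (cohomology m2)"
  proof (rule ring_hom_memI)
    fix H assume "H \<in> carrier (cohomology m0)"
    then show "\<phi> H \<in> carrier (cohomology m2)"
      unfolding carrier_cohomology[OF mem(1)] carrier_cohomology[OF mem(2)] using \<phi> by auto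
  next
    fix H K assume "H \<in> carrier (cohomology m0)" "K \<in> carrier (cohomology m0)"
    then obtain s t where st: "s \<in> D1_cocycles" "t \<in> D1_cocycles"
      "H = cohomology_class m0 s" "K = cohomology_class m0 t"
      unfolding carrier_cohomology[OF mem(1)] by blast
    then have c: "s \<in> cocycles m0" "t \<in> cocycles m0" "s \<in> cocycles m2" "t \<in> cocycles m2"
      using D1_cocycles_subset[OF mem(1)] D1_cocycles_subset[OF mem(2)] by auto
    show "\<phi> (H \<otimes>\<^bsub>cohomology m0\<^esub> K) = \<phi> H \<otimes>\<^bsub>cohomology m2\<^esub> \<phi> K"
      using st c by (simp only: cohomology_class_mult[OF mem(1)] cohomology_class_mult[OF mem(2)]
          \<phi> D1_cocycles_closed)
    show "\<phi> (H \<oplus>\<^bsub>cohomology m0\<^esub> K) = \<phi> H \<oplus>\<^bsub>cohomology m2\<^esub> \<phi> K"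
      using st c by (simp only: cohomology_class_add[OF mem(1)] cohomology_class_add[OF mem(2)]
          \<phi> D1_cocycles_closed)
  next
    show "\<phi> \<one>\<^bsub>cohomology m0\<^esub> = \<one>\<^bsub>cohomology m2\<^esub>"
      by (simp only: cohomology_one[OF mem(1)] cohomology_one[OF mem(2)] \<phi> D1_cocycles_closed)
  qed
  moreover have "bij_betw \<phi> (carrier (cohomology m0)) (carrier (cohomology m2))"
    unfolding bij_betw_def carrier_cohomology[OF mem(1)] carrier_cohomology[OF mem(2)]
  proof
    show "inj_on \<phi> (cohomology_class m0 ` D1_cocycles)"
      by (rule inj_onI) (use \<phi> eq_iff in \<open>elim imageE, simp\<close>)
    show "\<phi> ` cohomology_class m0 ` D1_cocycles = cohomology_class m2 ` D1_cocycles"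
      unfolding image_image using \<phi> by (intro image_cong refl) auto
  qed
  moreover have "\<phi> ` cohomology_degree m0 q = cohomology_degree m2 q" for q
    unfolding cohomology_degree_eq[OF mem(1)] cohomology_degree_eq[OF mem(2)] image_image
    using \<phi> by (intro image_cong refl) auto
  ultimately show ?thesis
    unfolding ring_iso_def by blast
qed

theorem theorem1:
  shows "(\<exists>\<phi>\<in>ring_iso (cohomology m0) (cohomology m2).
            \<forall>q. \<phi> ` cohomology_degree m0 q = cohomology_degree m2 q)
       \<and> (\<forall>\<gg>\<in>{m0, m2}.
            (\<forall>x\<in>generator_index. generator x \<in> cocycles \<gg>)
          \<and> inj_on (\<lambda>x. cohomology_class \<gg> (generator x)) generator_index
          \<and> vectorspace.basis class_ring (positive_cohomology \<gg>)
              ((\<lambda>x. cohomology_class \<gg> (generator x)) ` generator_index))"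
proof (rule conjI[OF ring_iso_cohomology], rule ballI)
  fix \<gg> :: lie assume \<gg>: "\<gg> \<in> {m0, m2}"
  have "\<forall>x\<in>generator_index. generator x \<in> cocycles \<gg>"
    using generator_D1_cocycles D1_cocycles_subset[OF \<gg>] by blast
  with cohomology_class_generator_inj[OF \<gg>] basis_positive_cohomology[OF \<gg>]
  show "(\<forall>x\<in>generator_index. generator x \<in> cocycles \<gg>)
      \<and> inj_on (\<lambda>x. cohomology_class \<gg> (generator x)) generator_index
      \<and> vectorspace.basis class_ring (positive_cohomology \<gg>)
          ((\<lambda>x. cohomology_class \<gg> (generator x)) ` generator_index)"
    by (intro conjI)
qed

end
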